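(* (Weyl–Poisson identity.) Let $L=L^\dagger\succeq0$ and $G=G^\dagger$ be matrices of the same finite size (not assumed to commute), and let $T>0$, $c>0$, $\gamma>0$. Let $q$, $\phi$ and $\operatorname{Op}^{\mathrm W}_{TL,TG}$ be as in the context. Then for every $h>0$, with series converging in operator norm, $$h\sum_{m\in\mathbb Z}q(mh)e^{-iT(mhL+G)}=\operatorname{Op}^{\mathrm W}_{TL,TG}\big[e^{-iy}\phi(x)\big]+\sum_{\ell\ne0}\operatorname{Op}^{\mathrm W}_{TL,TG}\Big[e^{-iy}\phi\big(x+\tfrac{2\pi\ell}{h}\big)\Big].$$ Consequently, for every $N\in\mathbb N$, $$h\sum_{m=-N}^{N}q(mh)e^{-iT(mhL+G)}-e^{-T(L+iG)}=\Big\{\operatorname{Op}^{\mathrm W}_{TL,TG}\big[e^{-iy}\phi(x)\big]-e^{-T(L+iG)}\Big\}+\sum_{\ell\ne0}\operatorname{Op}^{\mathrm W}_{TL,TG}\Big[e^{-iy}\phi\big(x+\tfrac{2\pi\ell}{h}\big)\Big]-h\sum_{|m|>N}q(mh)e^{-iT(mhL+G)}.$$ Moreover, the identity in the transformed variable $k=\sinh z$ holds: for every $h>0$, $$h\sum_{m\in\mathbb Z}\cosh(mh)\,q(\sinh(mh))\,e^{-iT(\sinh(mh)L+G)}=\int_{\mathbb R}q(k)e^{-iT(kL+G)}\,dk+\sum_{\ell\ne0}\int_{\mathbb R}\cosh z\;q(\sinh z)\,e^{-iT(\sinh z\,L+G)}e^{-2\pi i\ell z/h}\,dz .$$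
   Context: The scalar kernel and its transform are $$q(k)=\frac{e^{c-ick}}{\pi(1+k^2)}\exp\!\Big[-\frac{k^2+1}{4\gamma^2}\Big],\qquad \phi(x)=\int_{\mathbb R}q(k)e^{-ikx}\,dk .$$ For real $a$, the Weyl operator is defined by the norm-convergent integral $$\operatorname{Op}^{\mathrm W}_{TL,TG}\big[e^{-iy}\phi(x+a)\big]:=\int_{\mathbb R}q(k)e^{-iak}e^{-iT(kL+G)}\,dk .$$ Here $x,y$ are formal symbol variables associated with $TL$ and $TG$. *)

theory Defs
  imports "HOL-Analysis.Analysis"
begin

section \<open>Complex matrices\<close>

definition cscale :: "complex \<Rightarrow> complex^'n^'m \<Rightarrow> complex^'n^'m"  (infixr \<open>*\<^sub>M\<close> 75)
  where "z *\<^sub>M A = map_matrix (\<lambda>w. z * w) A"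

definition hermitian :: "complex^'n^'n \<Rightarrow> bool"
  where "hermitian A \<longleftrightarrow> map_matrix cnj (transpose A) = A"

text \<open>For Hermitian \<open>A\<close> the quadratic form is real, so taking the real part loses nothing.\<close>

definition pos_semidef :: "complex^'n^'n \<Rightarrow> bool"
  where "pos_semidef A \<longleftrightarrow>
    hermitian A \<and> (\<forall>v. 0 \<le> Re (\<Sum>i\<in>UNIV. cnj (v $ i) * (A *v v) $ i))"

text \<open>The library operations \<open>*\<close>, \<open>^\<close> and \<open>1\<close> on vectors are componentwise,
  so matrix powers are built from \<open>**\<close> and \<open>mat 1\<close>.\<close>

primrec mpow :: "complex^'n^'n \<Rightarrow> nat \<Rightarrow> complex^'n^'n" where
  "mpow A 0 = mat 1"
| "mpow A (Suc n) = A ** mpow A n"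

definition mexp :: "complex^'n^'n \<Rightarrow> complex^'n^'n"
  where "mexp A = (\<Sum>n. (1 / fact n) *\<^sub>R mpow A n)"

text \<open>The norm of the type \<open>complex^'n^'n\<close> is the Frobenius norm; this is the operator norm
  induced by the Euclidean norm of \<open>complex^'n\<close>.\<close>

definition op_norm :: "complex^'n^'n \<Rightarrow> real"
  where "op_norm A = onorm (\<lambda>v. A *v v)"

text \<open>Unconditional convergence in operator norm, with the library sum as its limit.\<close>

definition op_norm_summable :: "('i \<Rightarrow> complex^'n^'n) \<Rightarrow> 'i set \<Rightarrow> bool"
  where "op_norm_summable f I \<longleftrightarrow>
    ((\<lambda>F. op_norm (sum f F - infsum f I)) \<longlongrightarrow> 0) (finite_subsets_at_top I)"


section \<open>The scalar kernel and the Weyl operator\<close>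

definition q_kernel :: "real \<Rightarrow> real \<Rightarrow> real \<Rightarrow> complex"
  where "q_kernel c \<gamma> k =
    exp (complex_of_real c - \<i> * complex_of_real (c * k)) / complex_of_real (pi * (1 + k\<^sup>2))
      * complex_of_real (exp (- ((k\<^sup>2 + 1) / (4 * \<gamma>\<^sup>2))))"

definition \<phi>_transform :: "real \<Rightarrow> real \<Rightarrow> real \<Rightarrow> complex"
  where "\<phi>_transform c \<gamma> x =
    (LINT k|lborel. q_kernel c \<gamma> k * exp (- \<i> * complex_of_real (k * x)))"

definition evol :: "real \<Rightarrow> complex^'n^'n \<Rightarrow> complex^'n^'n \<Rightarrow> real \<Rightarrow> complex^'n^'n"
  where "evol T L G k = mexp ((- \<i> * complex_of_real T) *\<^sub>M (k *\<^sub>R L + G))"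

definition weyl_integrand ::
    "real \<Rightarrow> real \<Rightarrow> real \<Rightarrow> complex^'n^'n \<Rightarrow> complex^'n^'n \<Rightarrow> real \<Rightarrow> real \<Rightarrow> complex^'n^'n"
  where "weyl_integrand c \<gamma> T L G a k =
    (q_kernel c \<gamma> k * exp (- \<i> * complex_of_real (a * k))) *\<^sub>M evol T L G k"

text \<open>\<open>weyl_op c \<gamma> T L G a\<close> is the Weyl operator, with respect to \<open>T L\<close> and \<open>T G\<close>, of the formal
  symbol \<open>exp(- i y) \<phi>(x + a)\<close>. By lemma \<open>\<phi>_transform_shift\<close> that symbol is the integral of
  \<open>q(k) exp(- i a k) exp(- i (k x + y))\<close> over \<open>k\<close>, and Weyl quantisation replaces
  \<open>exp(- i (k x + y))\<close> by \<open>evol T L G k\<close>, the exponential of \<open>- i (k T L + T G)\<close>.\<close>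

definition weyl_op ::
    "real \<Rightarrow> real \<Rightarrow> real \<Rightarrow> complex^'n^'n \<Rightarrow> complex^'n^'n \<Rightarrow> real \<Rightarrow> complex^'n^'n"
  where "weyl_op c \<gamma> T L G a = (LINT k|lborel. weyl_integrand c \<gamma> T L G a k)"

lemma \<phi>_transform_shift:
  "\<phi>_transform c \<gamma> (x + a) =
    (LINT k|lborel. (q_kernel c \<gamma> k * exp (- \<i> * complex_of_real (a * k)))
                      * exp (- \<i> * complex_of_real (k * x)))"
  unfolding \<phi>_transform_def
  by (intro Bochner_Integration.integral_cong refl)
     (simp add: algebra_simps exp_diff exp_minus divide_inverse)

end

theory Submission
  imports Defs "HOL-Complex_Analysis.Complex_Analysis" "HOL-Probability.Sinc_Integral"
    "HOL-Real_Asymp.Real_Asymp"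
begin

text \<open>
  Everything is Poisson summation, applied entrywise to \<open>k \<mapsto> q(k) exp(- i T (k L + G))\<close> and to
  \<open>z \<mapsto> cosh z q(sinh z) exp(- i T (sinh z L + G))\<close>. Both extend holomorphically to the strip
  \<open>\<bar>Im z\<bar> < 1/2\<close>. There the entries of the matrix exponential grow at most exponentially in the
  modulus of its argument, which the Gaussian factor of \<open>q\<close> (respectively a factor
  \<open>exp(- \<alpha> cosh(Re z)^2)\<close>) absorbs, so both functions are \<open>O(1 / (1 + (Re z)^2))\<close>. The Cauchy inequalities carry the decay over to the first two
  derivatives on the real line, hence the Fourier transform decays quadratically as well. The
  periodisation is differentiable, and the Dirichlet kernel recovers its value at the lattice points
  from its Fourier coefficients, which are samples of the Fourier transform.
\<close>

section \<open>Fourier series of differentiable periodic functions\<close>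

text \<open>The Dirichlet kernel controls only symmetric partial sums, whereas unconditional
  convergence is claimed. Summability of the Fourier side is therefore established on its own, from
  the second derivative, and the kernel merely identifies the value of a sum already known to exist.
  The half-width 1/2 suits both integrands. The poles of the kernel at i and -i lie outside. After k
  = sinh z the Gaussian exponent is governed by the real part of (cosh z)^2, which for large |Re z|
  behaves like (cosh (Re z))^2 cos (2 Im z); decay thus forces a half-width below pi/4, and the
  zeros of cosh nearest the real line, i pi/2 and -i pi/2, are then outside as well. Since L and G
  need not commute, no product formula for the exponential is available. Only its power series is
  used: it yields holomorphy of every entry in k and the growth bound, after which all analysis is
  scalar.\<close>

lemma Riemann_Lebesgue_sin:
  fixes u :: "real \<Rightarrow> complex"
  assumes "continuous_on {0..1} u"
  shows "((\<lambda>\<omega>. integral {0..1} (\<lambda>x. u x * of_real (sin (\<omega> * x)))) \<longlongrightarrow> 0) at_top"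
proof (rule tendstoI)
  fix e :: real assume "e > 0"
  \<comment> \<open>\<open>u\<close> is only continuous, so integration by parts is applied to a
    polynomial instead. The error is at most e/2 uniformly in \<omega>; the polynomial part is
    O(1/\<omega>), with \<open>2 * B\<close> from the two boundary terms and \<open>B'\<close> from
    the remaining integral.\<close>
  obtain p where "polynomial_function p" and p: "\<And>x. x \<in> {0..1} \<Longrightarrow> norm (u x - p x) < e / 2"
    using Stone_Weierstrass_polynomial_function[of "{0..1}" u "e / 2"] assms \<open>e > 0\<close> by auto
  obtain p' where "polynomial_function p'" and p': "\<And>x. (p has_vector_derivative p' x) (at x)"
    using has_vector_derivative_polynomial_function[OF \<open>polynomial_function p\<close>] by blast
  have cont: "continuous_on {0..1} p" "continuous_on {0..1} p'"
    by (rule continuous_on_polymonial_function; fact)+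
  obtain B where B: "\<And>x. x \<in> {0..1} \<Longrightarrow> norm (p x) \<le> B"
    using compact_imp_bounded[OF compact_continuous_image[OF cont(1) compact_Icc]]
    unfolding bounded_iff by fastforce
  obtain B' where B': "\<And>x. x \<in> {0..1} \<Longrightarrow> norm (p' x) \<le> B'"
    using compact_imp_bounded[OF compact_continuous_image[OF cont(2) compact_Icc]]
    unfolding bounded_iff by fastforce
  have bound: "norm (integral {0..1} (\<lambda>x. u x * of_real (sin (\<omega> * x)))) \<le> e / 2 + (2 * B + B') / \<omega>"
    if "\<omega> > 0" for \<omega>
  proof -
    let ?P = "\<lambda>x. - p x * of_real (cos (\<omega> * x) / \<omega>)"
    have "((\<lambda>x. p x * of_real (sin (\<omega> * x)) - p' x * of_real (cos (\<omega> * x) / \<omega>))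
            has_integral ?P 1 - ?P 0) {0..1}"
    proof (rule fundamental_theorem_of_calculus)
      fix x :: real
      have "(?P has_vector_derivative
         p x * of_real (sin (\<omega> * x)) - p' x * of_real (cos (\<omega> * x) / \<omega>)) (at x)"
        using p'[of x] \<open>\<omega> > 0\<close>
        by (auto intro!: derivative_eq_intros simp: has_real_derivative_iff_has_vector_derivative[symmetric] field_simps)
      then show "(?P has_vector_derivative
         p x * of_real (sin (\<omega> * x)) - p' x * of_real (cos (\<omega> * x) / \<omega>)) (at x within {0..1})"
        by (rule has_vector_derivative_at_within)
    qed auto
    then have "((\<lambda>x. p x * of_real (sin (\<omega> * x)) - p' x * of_real (cos (\<omega> * x) / \<omega>)
         + p' x * of_real (cos (\<omega> * x) / \<omega>))
            has_integral ?P 1 - ?P 0 + integral {0..1} (\<lambda>x. p' x * of_real (cos (\<omega> * x) / \<omega>))) {0..1}"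
      by (intro has_integral_add integrable_integral integrable_continuous_real continuous_intros cont)
         (use \<open>\<omega> > 0\<close> in auto)
    then have eq: "integral {0..1} (\<lambda>x. p x * of_real (sin (\<omega> * x)))
        = ?P 1 - ?P 0 + integral {0..1} (\<lambda>x. p' x * of_real (cos (\<omega> * x) / \<omega>))"
      by (simp add: integral_unique)
    have "norm (integral {0..1} (\<lambda>x. p' x * of_real (cos (\<omega> * x) / \<omega>))) \<le> integral {0..1} (\<lambda>x::real. B' / \<omega>)"
    proof (rule integral_norm_bound_integral)
      fix x :: real assume "x \<in> {0..1}"
      have "norm (p' x) * \<bar>cos (\<omega> * x)\<bar> \<le> B' * 1"
        using B'[OF \<open>x \<in> _\<close>] by (intro mult_mono) (auto intro: order_trans[OF norm_ge_zero])
      then show "norm (p' x * of_real (cos (\<omega> * x) / \<omega>)) \<le> B' / \<omega>"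
        using \<open>\<omega> > 0\<close> by (simp add: norm_mult norm_divide divide_right_mono)
    qed (use \<open>\<omega> > 0\<close> in \<open>auto intro!: integrable_continuous_real continuous_intros cont\<close>)
    moreover have "norm (?P x) \<le> B / \<omega>" if "x \<in> {0..1}" for x
    proof -
      have "norm (p x) * \<bar>cos (\<omega> * x)\<bar> \<le> B * 1"
        using B[OF that] by (intro mult_mono) (auto intro: order_trans[OF norm_ge_zero])
      then show ?thesis
        using \<open>\<omega> > 0\<close> by (simp add: norm_mult norm_divide divide_right_mono)
    qed
    from this[of 0] this[of 1] have "norm (?P 1 - ?P 0) \<le> B / \<omega> + B / \<omega>"
      by (intro order_trans[OF norm_triangle_ineq4] add_mono) auto
    ultimately have 1: "norm (integral {0..1} (\<lambda>x. p x * of_real (sin (\<omega> * x)))) \<le> (2 * B + B') / \<omega>"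
      unfolding eq by (intro order_trans[OF norm_triangle_ineq]) (simp add: add_divide_distrib)
    have 2: "norm (integral {0..1} (\<lambda>x. (u x - p x) * of_real (sin (\<omega> * x)))) \<le> integral {0..1} (\<lambda>x::real. e / 2)"
    proof (rule integral_norm_bound_integral)
      fix x :: real assume "x \<in> {0..1}"
      have "norm (u x - p x) * \<bar>sin (\<omega> * x)\<bar> \<le> e / 2 * 1"
        using p[OF \<open>x \<in> _\<close>] \<open>e > 0\<close> by (intro mult_mono) auto
      then show "norm ((u x - p x) * of_real (sin (\<omega> * x))) \<le> e / 2"
        by (simp add: norm_mult)
    qed (auto intro!: integrable_continuous_real continuous_intros cont assms)
    have "integral {0..1} (\<lambda>x. u x * of_real (sin (\<omega> * x)))
        = integral {0..1} (\<lambda>x. (u x - p x) * of_real (sin (\<omega> * x)))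
        + integral {0..1} (\<lambda>x. p x * of_real (sin (\<omega> * x)))"
      by (subst integral_add[symmetric])
         (auto intro!: integrable_continuous_real continuous_intros cont assms simp: algebra_simps)
    also have "norm \<dots> \<le> e / 2 + (2 * B + B') / \<omega>"
      by (rule norm_triangle_mono) (use 1 2 in simp_all)
    finally show ?thesis .
  qed
  have "((\<lambda>\<omega>. e / 2 + (2 * B + B') / \<omega>) \<longlongrightarrow> e / 2 + 0) at_top"
    by (intro tendsto_intros tendsto_divide_0[OF tendsto_const] filterlim_at_top_imp_at_infinity filterlim_ident)
  then have "eventually (\<lambda>\<omega>. e / 2 + (2 * B + B') / \<omega> < e) at_top"
    using \<open>e > 0\<close> by (intro order_tendstoD(2)[where y = "e / 2"]) auto
  then show "eventually (\<lambda>\<omega>. dist (integral {0..1} (\<lambda>x. u x * of_real (sin (\<omega> * x)))) 0 < e) at_top"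
    using eventually_gt_at_top[of 0]
    by eventually_elim (use bound in fastforce)
qed

text \<open>The sine is kept as a factor rather than a denominator, so integer \<open>x\<close>
  needs no exception. In the induction the two new terms add up to a doubled cosine, whose product
  with \<open>sin (pi * x)\<close> telescopes.\<close>

lemma Dirichlet_kernel:
  "(\<Sum>l = - int M..int M. cis (- (2 * pi * l * x))) * of_real (sin (pi * x))
     = of_real (sin ((2 * real M + 1) * pi * x))"
proof (induction M)
  case 0
  then show ?case by simp
next
  case (Suc M)
  have "{- int (Suc M)..int (Suc M)} = insert (- int (Suc M)) (insert (int (Suc M)) {- int M..int M})"
    by auto
  then have "(\<Sum>l = - int (Suc M)..int (Suc M). cis (- (2 * pi * l * x)))
      = cis (2 * pi * (Suc M) * x) + cis (- (2 * pi * (Suc M) * x)) + (\<Sum>l = - int M..int M. cis (- (2 * pi * l * x)))"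
    by (simp add: algebra_simps)
  moreover have "cis (2 * pi * (Suc M) * x) + cis (- (2 * pi * (Suc M) * x)) = of_real (2 * cos (2 * pi * (Suc M) * x))"
    by (simp add: complex_eq_iff)
  moreover have "2 * cos (2 * pi * (Suc M) * x) * sin (pi * x)
      = sin ((2 * real (Suc M) + 1) * pi * x) - sin ((2 * real M + 1) * pi * x)"
  proof -
    have "(2 * real (Suc M) + 1) * pi * x = 2 * pi * (Suc M) * x + pi * x" "(2 * real M + 1) * pi * x = 2 * pi * (Suc M) * x - pi * x"
      by (simp_all add: algebra_simps)
    then show ?thesis by (simp only: sin_add sin_diff)
  qed
  ultimately show ?case
    using Suc.IH by (simp only: distrib_right of_real_mult[symmetric] of_real_diff) simp
qed

text \<open>An unconditional sum can be evaluated along any exhaustion by finite sets. Symmetric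
  intervals match the Dirichlet kernel; the half-open ones {-N..<N} grow by the pair N, -N-1 and so
  turn a sum over the integers into an ordinary series, to which the M-test and termwise
  differentiation apply.\<close>

lemma has_sum_int_imp_symmetric_limit:
  fixes f :: "int \<Rightarrow> 'a::{topological_comm_monoid_add, t2_space}"
  assumes "(f has_sum S) UNIV"
  shows "(\<lambda>M::nat. \<Sum>m = - int M..int M. f m) \<longlonglongrightarrow> S"
    and "(\<lambda>n. f (int n) + f (- int n - 1)) sums S"
proof -
  have lim: "(\<lambda>M. sum f (X M)) \<longlonglongrightarrow> S"
    if X: "\<And>M. finite (X M)" and ex: "\<And>m. eventually (\<lambda>M. m \<in> X M) sequentially" for X :: "nat \<Rightarrow> int set"
  proof -
    have "filterlim X (finite_subsets_at_top UNIV) sequentially"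
      unfolding filterlim_finite_subsets_at_top
    proof (intro allI impI)
      fix Y :: "int set" assume "finite Y \<and> Y \<subseteq> UNIV"
      then have "eventually (\<lambda>M. \<forall>m\<in>Y. m \<in> X M) sequentially"
        using ex by (intro eventually_ball_finite) auto
      then show "\<forall>\<^sub>F M in sequentially. finite (X M) \<and> Y \<subseteq> X M \<and> X M \<subseteq> UNIV"
        by eventually_elim (use X in auto)
    qed
    then show ?thesis
      using assms unfolding has_sum_def by (rule filterlim_compose[rotated])
  qed
  show "(\<lambda>M::nat. \<Sum>m = - int M..int M. f m) \<longlonglongrightarrow> S"
  proof (rule lim)
    show "eventually (\<lambda>M. m \<in> {- int M..int M}) sequentially" for m
      using eventually_ge_at_top[of "nat \<bar>m\<bar>"] by eventually_elim auto
  qed auto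
  have "(\<Sum>n<N. f (int n) + f (- int n - 1)) = sum f {- int N..<int N}" for N
  proof (induction N)
    case (Suc N)
    have "{- int (Suc N)..<int (Suc N)} = insert (- int N - 1) (insert (int N) {- int N..<int N})"
      by auto
    then show ?case
      using Suc by (simp add: algebra_simps)
  qed simp
  moreover have "(\<lambda>N::nat. sum f {- int N..<int N}) \<longlonglongrightarrow> S"
  proof (rule lim)
    show "eventually (\<lambda>N. m \<in> {- int N..<int N}) sequentially" for m
      using eventually_gt_at_top[of "nat \<bar>m\<bar>"] by eventually_elim auto
  qed auto
  ultimately show "(\<lambda>n. f (int n) + f (- int n - 1)) sums S"
    unfolding sums_def by simp
qed

section \<open>Functions with quadratic decay and their Fourier transforms\<close>

lemma summable_recip_1_plus_square: "summable (\<lambda>n::nat. 1 / (1 + (real n)\<^sup>2))"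
proof (rule summable_comparison_test')
  show "summable (\<lambda>n. inverse (real n ^ 2))" by (rule inverse_power_summable) simp
  show "norm (1 / (1 + (real n)\<^sup>2)) \<le> inverse (real n ^ 2)" if "n \<ge> 1" for n
    using that by (auto simp: inverse_eq_divide intro!: frac_le)
qed

lemma summable_on_int_recip_1_plus_square:
  "(\<lambda>m::int. 1 / (1 + (real_of_int m)\<^sup>2)) summable_on UNIV"
proof -
  have nat: "(\<lambda>n::nat. 1 / (1 + (real n)\<^sup>2)) summable_on UNIV"
    by (rule summable_nonneg_imp_summable_on) (auto intro: summable_recip_1_plus_square)
  have "(\<lambda>m::int. 1 / (1 + (real_of_int m)\<^sup>2)) summable_on range int"
    using nat by (subst summable_on_reindex) (auto simp: o_def)
  moreover have "(\<lambda>m::int. 1 / (1 + (real_of_int m)\<^sup>2)) summable_on range (\<lambda>n. - int n)"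
    using nat by (subst summable_on_reindex) (auto simp: o_def inj_on_def)
  moreover have "range int \<union> range (\<lambda>n. - int n) = UNIV"
    by (auto simp: image_def) (metis int_cases2)
  ultimately show ?thesis
    using summable_on_union by metis
qed

text \<open>After clearing denominators the right-hand product expands to 1 + x^2 + (x h)^2 + 1/h^2.
  This is the price of rescaling the lattice to unit spacing.\<close>

lemma recip_1_plus_square_scale:
  fixes h x :: real
  assumes "h > 0"
  shows "1 / (1 + (x * h)\<^sup>2) \<le> (1 + 1 / h\<^sup>2) / (1 + x\<^sup>2)"
proof -
  have "1 + x\<^sup>2 \<le> (1 + 1 / h\<^sup>2) * (1 + (x * h)\<^sup>2)"
    using assms by (simp add: field_simps power2_eq_square)
  then show ?thesis
    by (simp add: field_simps add_pos_nonneg)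
qed

lemma integrable_recip_1_plus_square: "integrable lborel (\<lambda>x::real. K / (1 + x\<^sup>2))"
  using integrable_inverse_1_plus_square
  by (auto simp: set_integrable_def divide_inverse intro!: integrable_mult_right)

text \<open>Angular frequency convention: a shift \<open>a\<close> of the Weyl symbol is exactly the
  frequency \<open>a\<close>, and differentiation multiplies by i \<xi>.\<close>

definition fourier :: "(real \<Rightarrow> complex) \<Rightarrow> real \<Rightarrow> complex"
  where "fourier f \<xi> = (LINT x|lborel. f x * cis (- (\<xi> * x)))"

lemma integrable_of_quadratic_decay:
  fixes f :: "real \<Rightarrow> 'a::euclidean_space"
  assumes "continuous_on UNIV f" and "\<And>x. norm (f x) \<le> K / (1 + x\<^sup>2)"
  shows "integrable lborel f"
proof (rule Bochner_Integration.integrable_bound[OF integrable_recip_1_plus_square[of K]])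
  show "AE x in lborel. norm (f x) \<le> norm (K / (1 + x\<^sup>2))"
    unfolding real_norm_def by (intro AE_I2 order_trans[OF assms(2) abs_ge_self])
qed (use assms in \<open>simp add: borel_measurable_continuous_onI\<close>)

lemma quadratic_decay_tendsto_0:
  fixes f :: "real \<Rightarrow> 'a::real_normed_vector"
  assumes "\<And>x. norm (f x) \<le> K / (1 + x\<^sup>2)"
  shows "(f \<longlongrightarrow> 0) at_top" "(f \<longlongrightarrow> 0) at_bot"
proof -
  show "(f \<longlongrightarrow> 0) at_top"
    by (rule Lim_null_comparison[OF always_eventually[OF allI[OF assms]]]) real_asymp
  show "(f \<longlongrightarrow> 0) at_bot"
    by (rule Lim_null_comparison[OF always_eventually[OF allI[OF assms]]]) real_asymp
qed

lemma integrable_fourier: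
  assumes "continuous_on UNIV f" and "\<And>x. norm (f x) \<le> K / (1 + x\<^sup>2)"
  shows "integrable lborel (\<lambda>x. f x * cis (- (\<xi> * x)))"
  by (rule integrable_of_quadratic_decay[of _ K])
     (use assms in \<open>auto intro!: continuous_intros simp: norm_mult\<close>)

text \<open>Integration by parts over the whole line: \<open>?g\<close> is the derivative of f(x)
  cis(-\<xi> x), and the quadratic bound both makes it integrable and kills the boundary values at
  infinity.\<close>

lemma fourier_derivative:
  assumes deriv: "\<And>x. (f has_vector_derivative f' x) (at x)"
    and cont: "continuous_on UNIV f'"
    and bound: "\<And>x. norm (f x) \<le> K / (1 + x\<^sup>2)" "\<And>x. norm (f' x) \<le> K / (1 + x\<^sup>2)"
  shows "fourier f' \<xi> = \<i> * \<xi> * fourier f \<xi>"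
proof -
  have contf: "continuous_on UNIV f"
    using deriv by (meson continuous_at_imp_continuous_on has_vector_derivative_continuous)
  note int = integrable_fourier[OF contf bound(1), of \<xi>] integrable_fourier[OF cont bound(2), of \<xi>]
  let ?g = "\<lambda>x. f' x * cis (- (\<xi> * x)) - \<i> * \<xi> * (f x * cis (- (\<xi> * x)))"
  have intg: "integrable lborel ?g"
    by (intro Bochner_Integration.integrable_diff int integrable_mult_right)
  have lim: "norm (f x * cis (- (\<xi> * x))) \<le> K / (1 + x\<^sup>2)" for x
    using bound(1) by (simp add: norm_mult)
  have "(LBINT x=-\<infinity>..\<infinity>. ?g x) = 0 - 0"
  proof (rule interval_integral_FTC_integrable)
    fix x :: real
    have "((\<lambda>x. f x * cis (- (\<xi> * x))) has_vector_derivative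
            f' x * cis (- (\<xi> * x)) + f x * (- \<xi> *\<^sub>R (\<i> * cis (- (\<xi> * x))))) (at x)"
      using deriv[of x] unfolding has_vector_derivative_def
      by (auto intro!: derivative_eq_intros simp: algebra_simps scaleR_conv_of_real)
    then show "((\<lambda>x. f x * cis (- (\<xi> * x))) has_vector_derivative ?g x) (at x)"
      by (simp add: scaleR_conv_of_real algebra_simps)
    have "continuous_on UNIV ?g"
      by (intro continuous_intros contf cont)
    then show "isCont ?g x"
      by (simp add: continuous_on_eq_continuous_at)
  next
    show "set_integrable lborel (einterval (- \<infinity>) \<infinity>) ?g"
      using intg by (simp add: set_integrable_def)
  qed (use quadratic_decay_tendsto_0[OF lim] in \<open>simp_all add: ereal_tendsto_simps\<close>)
  then have "(LINT x|lborel. ?g x) = 0"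
    by (simp add: interval_lebesgue_integral_def set_lebesgue_integral_def)
  then have "fourier f' \<xi> - \<i> * \<xi> * fourier f \<xi> = 0"
    unfolding fourier_def using int by simp
  then show ?thesis by simp
qed

lemma norm_fourier_le:
  assumes "\<And>x. norm (f x) \<le> K / (1 + x\<^sup>2)"
  shows "norm (fourier f \<xi>) \<le> K * (LINT x|lborel. 1 / (1 + x\<^sup>2))"
proof -
  have "norm (fourier f \<xi>) \<le> (LINT x|lborel. K / (1 + x\<^sup>2))"
    unfolding fourier_def
    by (intro order_trans[OF integral_norm_bound] integral_mono')
       (use assms order_trans[OF norm_ge_zero assms] in \<open>auto simp: norm_mult integrable_recip_1_plus_square\<close>)
  then show ?thesis
    using integral_mult_right_zero[of lborel K "\<lambda>x. 1 / (1 + x\<^sup>2)"] by simp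
qed

section \<open>Convergence of symmetric Fourier sums at the period's endpoint\<close>

lemma has_vector_derivative_imp_quotient_tendsto:
  fixes f :: "real \<Rightarrow> 'a::real_normed_vector"
  assumes "(f has_vector_derivative f') (at x within S)"
  shows "((\<lambda>y. (f y - f x) /\<^sub>R (y - x)) \<longlongrightarrow> f') (at x within S)"
proof (rule LIM_zero_cancel, rule tendsto_norm_zero_cancel)
  have "((\<lambda>y. (1 / norm (y - x)) *\<^sub>R (f y - (f x + (y - x) *\<^sub>R f'))) \<longlongrightarrow> 0) (at x within S)"
    using assms unfolding has_vector_derivative_def has_derivative_within by blast
  then have "((\<lambda>y. norm ((1 / norm (y - x)) *\<^sub>R (f y - (f x + (y - x) *\<^sub>R f')))) \<longlongrightarrow> 0) (at x within S)"
    by (rule tendsto_norm_zero)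
  then show "((\<lambda>y. norm ((f y - f x) /\<^sub>R (y - x) - f')) \<longlongrightarrow> 0) (at x within S)"
  proof (rule Lim_transform_eventually)
    have "norm ((1 / norm (y - x)) *\<^sub>R (f y - (f x + (y - x) *\<^sub>R f'))) = norm ((f y - f x) /\<^sub>R (y - x) - f')"
      if "y \<noteq> x" for y
    proof -
      have "(f y - f x) /\<^sub>R (y - x) - f' = (1 / (y - x)) *\<^sub>R (f y - (f x + (y - x) *\<^sub>R f'))"
        using that by (simp add: scaleR_right_distrib scaleR_right_diff_distrib inverse_eq_divide)
      then show ?thesis by simp
    qed
    then show "\<forall>\<^sub>F y in at x within S. norm ((1 / norm (y - x)) *\<^sub>R (f y - (f x + (y - x) *\<^sub>R f')))
        = norm ((f y - f x) /\<^sub>R (y - x) - f')"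
      by (auto simp: eventually_at_filter)
  qed
qed

text \<open>Dividing \<open>g - g 0\<close> by \<open>sin (pi x)\<close> leaves a continuous function, so the remainder in the
  Dirichlet kernel formula is covered by the Riemann-Lebesgue lemma.\<close>

lemma symmetric_fourier_sums_tendsto:
  fixes g :: "real \<Rightarrow> complex"
  assumes deriv: "\<And>x. x \<in> {0..1} \<Longrightarrow> (g has_vector_derivative g' x) (at x within {0..1})"
    and per: "g 1 = g 0"
  shows "(\<lambda>M::nat. \<Sum>l = - int M..int M. integral {0..1} (\<lambda>x. g x * cis (- (2 * pi * l * x)))) \<longlonglongrightarrow> g 0"
proof -
  have contg: "continuous_on {0..1} g"
    using deriv by (meson continuous_on_eq_continuous_within has_vector_derivative_continuous)
  \<comment> \<open>\<open>sin (pi * x)\<close> has simple zeros at 0 and 1 with slopes pi and -pi;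
    the two exceptional values are the resulting limits of the quotient. At 1 the numerator vanishes
    only because of \<open>g 1 = g 0\<close>.\<close>
  define u where "u x = (if x = 0 then g' 0 / pi else if x = 1 then - g' 1 / pi
                          else (g x - g 0) / of_real (sin (pi * x)))" for x
  have sin_pos: "sin (pi * x) > 0" if "x \<in> {0<..<1}" for x :: real
    using that by (intro sin_gt_zero) (auto simp: field_simps)
  have "continuous_on {0..1} u"
    unfolding continuous_on_eq_continuous_within
  proof
    fix x :: real assume x: "x \<in> {0..1}"
    consider "x = 0" | "x = 1" | "x \<in> {0<..<1}" using x by fastforce
    then show "continuous (at x within {0..1}) u"
    proof cases
      case 1
      have "((\<lambda>x. (g x - g 0) /\<^sub>R (x - 0)) \<longlongrightarrow> g' 0) (at 0 within {0..1})"
        by (intro has_vector_derivative_imp_quotient_tendsto deriv) auto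
      moreover have "((\<lambda>x::real. x / sin (pi * x)) \<longlongrightarrow> inverse pi) (at 0)"
        by real_asymp
      then have "((\<lambda>x::real. x / sin (pi * x)) \<longlongrightarrow> inverse pi) (at 0 within {0..1})"
        by (rule tendsto_within_subset) simp
      ultimately have "((\<lambda>x. of_real (x / sin (pi * x)) * ((g x - g 0) /\<^sub>R (x - 0))) \<longlongrightarrow> of_real (inverse pi) * g' 0)
          (at 0 within {0..1})"
        by (intro tendsto_intros)
      then have "(u \<longlongrightarrow> of_real (inverse pi) * g' 0) (at 0 within {0..1})"
      proof (rule Lim_transform_eventually)
        have ev: "\<forall>\<^sub>F x in at 0 within {0..1}. x \<noteq> 0 \<and> x \<noteq> (1::real)"
          unfolding eventually_at by (intro exI[of _ 1]) (auto simp: dist_real_def)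
        show "\<forall>\<^sub>F x in at 0 within {0..1}. of_real (x / sin (pi * x)) * ((g x - g 0) /\<^sub>R (x - 0)) = u x"
          using ev
          by eventually_elim (simp add: u_def per scaleR_conv_of_real inverse_eq_divide)
      qed
      then show ?thesis using 1 by (simp add: continuous_within u_def field_simps)
    next
      case 2
      have "((\<lambda>x. (g x - g 1) /\<^sub>R (x - 1)) \<longlongrightarrow> g' 1) (at 1 within {0..1})"
        by (intro has_vector_derivative_imp_quotient_tendsto deriv) auto
      moreover have "((\<lambda>x::real. (x - 1) / sin (pi * x)) \<longlongrightarrow> - inverse pi) (at 1)"
        by real_asymp
      then have "((\<lambda>x::real. (x - 1) / sin (pi * x)) \<longlongrightarrow> - inverse pi) (at 1 within {0..1})"
        by (rule tendsto_within_subset) simp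
      ultimately have "((\<lambda>x. of_real ((x - 1) / sin (pi * x)) * ((g x - g 1) /\<^sub>R (x - 1))) \<longlongrightarrow> of_real (- inverse pi) * g' 1)
          (at 1 within {0..1})"
        by (intro tendsto_intros)
      then have "(u \<longlongrightarrow> of_real (- inverse pi) * g' 1) (at 1 within {0..1})"
      proof (rule Lim_transform_eventually)
        have ev: "\<forall>\<^sub>F x in at 1 within {0..1}. x \<noteq> 0 \<and> x \<noteq> (1::real)"
          unfolding eventually_at by (intro exI[of _ 1]) (auto simp: dist_real_def)
        show "\<forall>\<^sub>F x in at 1 within {0..1}. of_real ((x - 1) / sin (pi * x)) * ((g x - g 1) /\<^sub>R (x - 1)) = u x"
          using ev
          by eventually_elim (simp add: u_def per scaleR_conv_of_real inverse_eq_divide)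
      qed
      then show ?thesis using 2 by (simp add: continuous_within u_def field_simps)
    next
      case 3
      have "continuous_on {0<..<1} (\<lambda>x. (g x - g 0) / of_real (sin (pi * x)))"
        by (intro continuous_intros continuous_on_subset[OF contg]) (use sin_pos in force)+
      then have "continuous_on {0<..<1} u"
        by (rule continuous_on_eq) (auto simp: u_def)
      then have "isCont u x"
        using 3 by (metis continuous_on_eq_continuous_at open_greaterThanLessThan)
      then show ?thesis
        by (rule continuous_at_imp_continuous_at_within)
    qed
  qed
  then have "((\<lambda>\<omega>. integral {0..1} (\<lambda>x. u x * of_real (sin (\<omega> * x)))) \<longlongrightarrow> 0) at_top"
    by (rule Riemann_Lebesgue_sin)
  moreover have "filterlim (\<lambda>M::nat. (2 * real M + 1) * pi) at_top sequentially"
    by real_asymp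
  ultimately have "(\<lambda>M::nat. integral {0..1} (\<lambda>x. u x * of_real (sin ((2 * real M + 1) * pi * x)))) \<longlonglongrightarrow> 0"
    by (rule filterlim_compose)
  \<comment> \<open>By orthogonality, subtracting the constant \<open>g 0\<close> changes only the
    coefficient at l = 0. Writing the difference as \<open>u x * sin (pi * x)\<close> supplies the
    sine factor that the Dirichlet kernel formula asks for.\<close>
  moreover have "(\<Sum>l = - int M..int M. integral {0..1} (\<lambda>x. g x * cis (- (2 * pi * l * x))))
      = g 0 + integral {0..1} (\<lambda>x. u x * of_real (sin ((2 * real M + 1) * pi * x)))" for M
  proof -
    have orth: "integral {0..1} (\<lambda>x. cis (- (2 * pi * l * x))) = (if l = 0 then 1 else 0)" for l :: int
    proof (cases "l = 0")
      case False
      let ?F = "\<lambda>x. cis (- (2 * pi * l * x)) * (\<i> / (2 * pi * l))"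
      have "((\<lambda>x. cis (- (2 * pi * l * x))) has_integral ?F 1 - ?F 0) {0..1}"
      proof (rule fundamental_theorem_of_calculus)
        fix x :: real
        show "(?F has_vector_derivative cis (- (2 * pi * l * x))) (at x within {0..1})"
          unfolding has_vector_derivative_def using False
          by (auto intro!: derivative_eq_intros simp: scaleR_conv_of_real fun_eq_iff field_simps)
      qed simp
      moreover have "cis (- (2 * pi * l)) = 1"
        using cis_multiple_2pi[of "- of_int l"] by simp
      ultimately show ?thesis
        using False by (simp add: integral_unique)
    qed simp
    have split: "integral {0..1} (\<lambda>x. g x * cis (- (2 * pi * l * x)))
        = integral {0..1} (\<lambda>x. (g x - g 0) * cis (- (2 * pi * l * x))) + g 0 * (if l = 0 then 1 else 0)" for l :: int
      unfolding orth[symmetric] integral_mult_right[symmetric]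
      by (subst integral_add[symmetric])
         (auto intro!: integrable_continuous_real continuous_intros contg simp: algebra_simps)
    have "(\<Sum>l = - int M..int M. integral {0..1} (\<lambda>x. (g x - g 0) * cis (- (2 * pi * l * x))))
        = integral {0..1} (\<lambda>x. \<Sum>l = - int M..int M. (g x - g 0) * cis (- (2 * pi * l * x)))"
      by (rule integral_sum[symmetric]) (auto intro!: integrable_continuous_real continuous_intros contg)
    also have "\<dots> = integral {0..1} (\<lambda>x. u x * of_real (sin ((2 * real M + 1) * pi * x)))"
    proof (rule integral_cong)
      fix x :: real assume "x \<in> {0..1}"
      then have "g x - g 0 = u x * of_real (sin (pi * x))"
        using sin_pos[of x] per by (auto simp: u_def)
      then show "(\<Sum>l = - int M..int M. (g x - g 0) * cis (- (2 * pi * l * x))) = u x * of_real (sin ((2 * real M + 1) * pi * x))"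
        unfolding sum_distrib_left[symmetric] Dirichlet_kernel[symmetric] by (simp add: mult_ac)
    qed
    finally show ?thesis
      by (simp add: split sum.distrib sum_distrib_left[symmetric])
  qed
  ultimately show ?thesis
    by (auto intro: tendsto_eq_intros)
qed

section \<open>Poisson summation\<close>

lemma has_sum_int_shift:
  assumes "(f has_sum S) (UNIV :: int set)"
  shows "((\<lambda>m. f (m + k)) has_sum S) UNIV"
  using assms has_sum_reindex_bij_betw[of "\<lambda>m. m + k" UNIV UNIV f S]
  by (simp add: bij_plus_right)

text \<open>Bridge between two integrals: the coefficients of the periodisation arise as gauge
  integrals over bounded intervals, while \<open>fourier\<close> is a Lebesgue integral over the
  line.\<close>

lemma tendsto_integral_symmetric_interval:
  fixes f :: "real \<Rightarrow> 'a::euclidean_space"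
  assumes "integrable lborel f"
  shows "(\<lambda>N::nat. integral {- real N..real N} f) \<longlonglongrightarrow> (LINT x|lborel. f x)"
proof -
  have int: "set_integrable lborel A f" if "A \<in> sets borel" for A
    using assms that unfolding set_integrable_def by (simp add: integrable_mult_indicator)
  have Un: "(\<Union>N::nat. {- real N..real N}) = UNIV"
  proof -
    have "\<exists>N. x \<in> {- real N..real N}" for x
      using real_arch_simple[of "\<bar>x\<bar>"] by (simp add: abs_le_iff minus_le_iff conj_commute)
    then show ?thesis by auto
  qed
  have "(\<lambda>N::nat. LINT x:{- real N..real N}|lborel. f x) \<longlonglongrightarrow> (LINT x:(\<Union>N::nat. {- real N..real N})|lborel. f x)"
    by (rule set_integral_cont_up) (auto intro!: int simp: incseq_def Un)
  then show ?thesis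
    unfolding Un using set_borel_integral_eq_integral(2)[OF int]
    by (simp add: set_lebesgue_integral_def)
qed

text \<open>The three bounds have separate tasks: the one on \<open>f\<close> makes the
  periodisation converge, the one on \<open>f'\<close> makes it differentiable, and the one on
  \<open>f''\<close> makes its Fourier coefficients absolutely summable.\<close>

theorem Poisson_summation_unit:
  fixes f f' f'' :: "real \<Rightarrow> complex"
  assumes deriv: "\<And>x. (f has_vector_derivative f' x) (at x)" "\<And>x. (f' has_vector_derivative f'' x) (at x)"
    and cont: "continuous_on UNIV f''"
    and bound: "\<And>x. norm (f x) \<le> K / (1 + x\<^sup>2)" "\<And>x. norm (f' x) \<le> K / (1 + x\<^sup>2)"
      "\<And>x. norm (f'' x) \<le> K / (1 + x\<^sup>2)"
  shows "(\<lambda>m::int. f m) summable_on UNIV"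
    and "((\<lambda>l::int. fourier f (2 * pi * l)) has_sum (\<Sum>\<^sub>\<infinity>m::int. f m)) UNIV"
proof -
  have contf: "continuous_on A f" and contf': "continuous_on A f'" for A
    using deriv by (meson continuous_at_imp_continuous_on has_vector_derivative_continuous)+
  have "K \<ge> 0"
    using order_trans[OF norm_ge_zero bound(1)[of 0]] by simp
  have summ: "(\<lambda>m::int. f m) summable_on UNIV"
  proof (rule Infinite_Sum.abs_summable_summable, rule Infinite_Sum.abs_summable_on_comparison_test')
    show "(\<lambda>m::int. K * (1 / (1 + (real_of_int m)\<^sup>2))) summable_on UNIV"
      by (intro summable_on_cmult_right summable_on_int_recip_1_plus_square)
  qed (use bound in auto)
  then show "(\<lambda>m::int. f m) summable_on UNIV" .
  define S where "S = (\<Sum>\<^sub>\<infinity>m::int. f m)"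
  have hasS: "((\<lambda>m::int. f m) has_sum S) UNIV"
    using summ by (simp add: S_def)
  define I where "I = (LINT x|lborel. 1 / (1 + x\<^sup>2) :: real)"
  \<comment> \<open>Sum of two estimates by \<open>K * I\<close>: one of the transform itself, which
    covers l = 0, and one of the transform times l^2, from applying the derivative rule twice and
    discarding (2 pi)^2 \<ge> 1.\<close>
  have fourier_bound: "norm (fourier f (2 * pi * l)) \<le> 2 * K * I * (1 / (1 + (real_of_int l)\<^sup>2))" for l :: int
  proof -
    have "norm (fourier f (2 * pi * l)) * (2 * pi * l)\<^sup>2 = norm (fourier f'' (2 * pi * l))"
      using fourier_derivative[OF deriv(1) contf' bound(1,2)] fourier_derivative[OF deriv(2) cont bound(2,3)]
      by (simp add: norm_mult power2_eq_square abs_mult)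
    also have "\<dots> \<le> K * I"
      unfolding I_def by (rule norm_fourier_le[OF bound(3)])
    finally have 1: "norm (fourier f (2 * pi * l)) * (2 * pi * l)\<^sup>2 \<le> K * I" .
    have "1 * (real_of_int l)\<^sup>2 \<le> (2 * pi)\<^sup>2 * (real_of_int l)\<^sup>2"
      using pi_gt3 by (intro mult_right_mono one_le_power) auto
    then have "norm (fourier f (2 * pi * l)) * (real_of_int l)\<^sup>2 \<le> norm (fourier f (2 * pi * l)) * (2 * pi * l)\<^sup>2"
      by (intro mult_left_mono) (simp_all add: power_mult_distrib)
    with 1 have "norm (fourier f (2 * pi * l)) * (real_of_int l)\<^sup>2 \<le> K * I" by linarith
    moreover have "norm (fourier f (2 * pi * l)) \<le> K * I"
      unfolding I_def by (rule norm_fourier_le[OF bound(1)])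
    ultimately have "norm (fourier f (2 * pi * l)) * (1 + (real_of_int l)\<^sup>2) \<le> 2 * K * I"
      by (simp add: distrib_left)
    then show ?thesis
      by (simp add: pos_le_divide_eq add_pos_nonneg)
  qed
  have "(\<lambda>l::int. fourier f (2 * pi * l)) summable_on UNIV"
    by (rule Infinite_Sum.abs_summable_summable, rule Infinite_Sum.abs_summable_on_comparison_test'[OF _ fourier_bound])
       (intro summable_on_cmult_right summable_on_int_recip_1_plus_square)
  then have hasF: "((\<lambda>l::int. fourier f (2 * pi * l)) has_sum (\<Sum>\<^sub>\<infinity>l::int. fourier f (2 * pi * l))) UNIV"
    by simp

  \<comment> \<open>\<open>g x = (\<Sum>n. b f n x)\<close> below is the periodisation of \<open>f\<close>, with the integers paired as \<open>n, -n-1\<close>.\<close>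
  define b where "b F n x = F (x + real n) + F (x - real n - 1)" for F :: "real \<Rightarrow> complex" and n x
  \<comment> \<open>For x in [0,1] both x + n and x - n - 1 have modulus at least n. This pairing
    therefore gives one majorant valid on the whole closed interval, including n = 0.\<close>
  have b_bound: "norm (b F n x) \<le> 2 * K * (1 / (1 + (real n)\<^sup>2))"
    if F: "\<And>x. norm (F x) \<le> K / (1 + x\<^sup>2)" and x: "x \<in> {0..1}" for F n x
  proof -
    have "norm (F y) \<le> K / (1 + (real n)\<^sup>2)" if "real n \<le> \<bar>y\<bar>" for y
    proof -
      have "(real n)\<^sup>2 \<le> y\<^sup>2"
        using that by (simp add: abs_le_square_iff[symmetric])
      then show ?thesis
        using \<open>K \<ge> 0\<close> by (intro order_trans[OF F] divide_left_mono) (auto intro!: mult_pos_pos add_pos_nonneg)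
    qed
    from this[of "x + real n"] this[of "x - real n - 1"] show ?thesis
      unfolding b_def using x by (intro order_trans[OF norm_triangle_ineq]) auto
  qed
  have summ_bound: "summable (\<lambda>n. 2 * K * (1 / (1 + (real n)\<^sup>2)))"
    by (intro summable_mult summable_recip_1_plus_square)
  define g' where "g' x = (\<Sum>n. b f' n x)" for x
  have contb: "continuous_on A (b f n)" for A n
    unfolding b_def by (intro continuous_intros continuous_on_compose2[OF contf[of UNIV]]) auto
  have sumb: "summable (\<lambda>n. b f n x)" if "x \<in> {0..1}" for x
    by (rule summable_comparison_test'[OF summ_bound b_bound[OF bound(1) that]])
  have unif: "uniform_limit {0..1} (\<lambda>N x. \<Sum>n<N. b f' n x) g' sequentially"
    unfolding g'_def by (rule Weierstrass_m_test[OF b_bound summ_bound]) (use bound in auto)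
  have "\<exists>g. \<forall>x\<in>{0..1}. (\<lambda>n. b f n x) sums g x \<and> (g has_derivative (\<lambda>h. h *\<^sub>R g' x)) (at x within {0..1})"
  proof (rule has_derivative_series)
    fix n x
    have shift: "((\<lambda>x. f (x + c)) has_vector_derivative f' (x + c)) (at x)" for c
    proof -
      have "((\<lambda>x. x + c) has_vector_derivative 1) (at x)"
        by (auto intro!: derivative_eq_intros simp: has_real_derivative_iff_has_vector_derivative[symmetric])
      from vector_diff_chain_at[OF this deriv(1)] show ?thesis
        by (simp add: o_def)
    qed
    have "(b f n has_vector_derivative b f' n x) (at x)"
      unfolding b_def using shift[of "real n"] shift[of "- real n - 1"]
      by (auto intro: has_vector_derivative_add simp: algebra_simps)
    then show "(b f n has_derivative (\<lambda>h. h *\<^sub>R b f' n x)) (at x within {0..1})"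
      unfolding has_vector_derivative_def by (rule has_derivative_at_withinI)
  next
    fix e :: real assume "e > 0"
    then have "\<forall>\<^sub>F N in sequentially. \<forall>x\<in>{0..1}. norm ((\<Sum>n<N. b f' n x) - g' x) < e"
      using unif by (simp add: uniform_limit_iff dist_norm)
    then show "\<forall>\<^sub>F N in sequentially. \<forall>x\<in>{0..1}. \<forall>h. norm ((\<Sum>n<N. h *\<^sub>R b f' n x) - h *\<^sub>R g' x) \<le> e * norm h"
    proof eventually_elim
      case (elim N)
      have "norm ((\<Sum>n<N. h *\<^sub>R b f' n x) - h *\<^sub>R g' x) \<le> e * norm h" if "x \<in> {0..1}" for x h
      proof -
        have "(\<Sum>n<N. h *\<^sub>R b f' n x) - h *\<^sub>R g' x = h *\<^sub>R ((\<Sum>n<N. b f' n x) - g' x)"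
          by (simp only: scaleR_sum_right scaleR_right_diff_distrib)
        then show ?thesis
          using elim[rule_format, OF that] by (simp add: mult.commute[of e] mult_left_mono)
      qed
      then show ?case by blast
    qed
  qed (use summable_sums[OF sumb[of 0]] in auto)
  then obtain g where g: "\<And>x. x \<in> {0..1} \<Longrightarrow> (\<lambda>n. b f n x) sums g x"
    and g': "\<And>x. x \<in> {0..1} \<Longrightarrow> (g has_vector_derivative g' x) (at x within {0..1})"
    unfolding has_vector_derivative_def by blast

  \<comment> \<open>At 1 the pairs are n + 1 and -n, so the value is the lattice sum shifted by one.
    This yields the periodicity that the convergence theorem for Fourier series requires.\<close>
  have "g 0 = S" "g 1 = S"
  proof -
    have "(\<lambda>n. b f n 0) sums S"
      using has_sum_int_imp_symmetric_limit(2)[OF hasS] by (simp add: b_def)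
    then show "g 0 = S"
      using g[of 0] sums_unique2 by auto
    have "(\<lambda>n. b f n 1) sums S"
      using has_sum_int_imp_symmetric_limit(2)[OF has_sum_int_shift[OF hasS, of 1]] by (simp add: b_def add.commute)
    then show "g 1 = S"
      using g[of 1] sums_unique2 by auto
  qed

  \<comment> \<open>The translates of [0,1] by n and -n-1, for n < N, tile [-N,N], and the
    exponential is invariant under integer shifts. Hence integrating the first N pairs over [0,1]
    integrates \<open>f\<close> times the exponential over [-N,N]; uniform convergence allows the
    passage to the limit.\<close>
  have coeff: "integral {0..1} (\<lambda>x. g x * cis (- (2 * pi * l * x))) = fourier f (2 * pi * l)" for l :: int
  proof -
    let ?e = "\<lambda>x::real. cis (- (2 * pi * l * x))"
    have "uniform_limit {0..1} (\<lambda>N x. \<Sum>n<N. b f n x * ?e x) (\<lambda>x. \<Sum>n. b f n x * ?e x) sequentially"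
      by (rule Weierstrass_m_test[OF _ summ_bound]) (use b_bound[OF bound(1)] in \<open>simp add: norm_mult\<close>)
    then obtain I J where I: "\<And>N. ((\<lambda>x. \<Sum>n<N. b f n x * ?e x) has_integral I N) {0..1}"
      and J: "((\<lambda>x. \<Sum>n. b f n x * ?e x) has_integral J) {0..1}" and "I \<longlonglongrightarrow> J"
      by (rule uniform_limit_integral) (auto intro!: continuous_intros contb)
    have ci: "(\<lambda>x. f x * ?e x) integrable_on {a..b}" for a b
      by (intro integrable_continuous_real continuous_intros contf)
    have shift: "integral {0..1} (\<lambda>x. f (x + of_int m) * ?e x) = integral {of_int m..of_int m + 1} (\<lambda>x. f x * ?e x)" for m :: int
    proof -
      have "?e (x + of_int m) = ?e x" for x
      proof -
        have "?e (x + of_int m) = ?e x * cis (2 * pi * of_int (- l * m))"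
          by (simp add: cis_mult algebra_simps)
        then show ?thesis by (subst (asm) cis_multiple_2pi) auto
      qed
      then show ?thesis
        using integral_shift[of 0 "of_int m" 1 "\<lambda>x. f x * ?e x"]
        by (simp add: o_def add.commute continuous_intros contf)
    qed
    have "I N = integral {- real N..real N} (\<lambda>x. f x * ?e x)" for N
    proof (induction N)
      case 0
      then show ?case using I[of 0] by (simp add: has_integral_0_eq)
    next
      case (Suc N)
      have "I (Suc N) = integral {0..1} (\<lambda>x. (\<Sum>n<N. b f n x * ?e x) + b f N x * ?e x)"
        using I[of "Suc N"] by (simp add: integral_unique)
      also have "\<dots> = I N + integral {0..1} (\<lambda>x. b f N x * ?e x)"
        using I[of N] by (subst integral_add) (auto intro!: integrable_continuous_real continuous_intros contb simp: integral_unique)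
      also have "integral {0..1} (\<lambda>x. b f N x * ?e x)
          = integral {0..1} (\<lambda>x. f (x + of_int (int N)) * ?e x) + integral {0..1} (\<lambda>x. f (x + of_int (- int N - 1)) * ?e x)"
        by (subst integral_add[symmetric])
           (auto intro!: integrable_continuous_real continuous_intros continuous_on_compose2[OF contf[of UNIV]]
             simp: b_def algebra_simps)
      also have "\<dots> = integral {real N..real (Suc N)} (\<lambda>x. f x * ?e x) + integral {- real (Suc N)..- real N} (\<lambda>x. f x * ?e x)"
        unfolding shift by (simp add: add.commute minus_diff_commute)
      also have "I N + \<dots> = integral {- real (Suc N)..real (Suc N)} (\<lambda>x. f x * ?e x)"
      proof -
        let ?J = "\<lambda>a b. integral {a..b} (\<lambda>x. f x * ?e x)"
        have "?J (- real (Suc N)) (- real N) + ?J (- real N) (real N) = ?J (- real (Suc N)) (real N)"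
          and "?J (- real (Suc N)) (real N) + ?J (real N) (real (Suc N)) = ?J (- real (Suc N)) (real (Suc N))"
          by (rule Henstock_Kurzweil_Integration.integral_combine[OF _ _ ci]; simp)+
        then show ?thesis
          unfolding Suc.IH by (simp only: add_ac)
      qed
      finally show ?case .
    qed
    then have I_eq: "I = (\<lambda>N. integral {- real N..real N} (\<lambda>x. f x * ?e x))"
      by (rule ext)
    have "I \<longlonglongrightarrow> fourier f (2 * pi * l)"
      unfolding fourier_def I_eq
      by (rule tendsto_integral_symmetric_interval[OF integrable_fourier[OF contf bound(1)]])
    with \<open>I \<longlonglongrightarrow> J\<close> have "J = fourier f (2 * pi * l)"
      by (rule LIMSEQ_unique)
    moreover have "integral {0..1} (\<lambda>x. g x * ?e x) = integral {0..1} (\<lambda>x. \<Sum>n. b f n x * ?e x)"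
      by (rule integral_cong) (use sums_mult2[OF g] sums_unique in blast)
    ultimately show ?thesis
      using J by (simp add: integral_unique)
  qed
  have "(\<lambda>M::nat. \<Sum>l = - int M..int M. fourier f (2 * pi * l)) \<longlonglongrightarrow> g 0"
    using symmetric_fourier_sums_tendsto[OF g'] \<open>g 0 = S\<close> \<open>g 1 = S\<close> unfolding coeff by simp
  with has_sum_int_imp_symmetric_limit(1)[OF hasF] have "(\<Sum>\<^sub>\<infinity>l::int. fourier f (2 * pi * l)) = S"
    using LIMSEQ_unique \<open>g 0 = S\<close> by metis
  with hasF show "((\<lambda>l::int. fourier f (2 * pi * l)) has_sum (\<Sum>\<^sub>\<infinity>m::int. f m)) UNIV"
    by (simp add: S_def)
qed

theorem Poisson_summation:
  fixes f f' f'' :: "real \<Rightarrow> complex"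
  assumes deriv: "\<And>x. (f has_vector_derivative f' x) (at x)" "\<And>x. (f' has_vector_derivative f'' x) (at x)"
    and cont: "continuous_on UNIV f''"
    and bound: "\<And>x. norm (f x) \<le> K / (1 + x\<^sup>2)" "\<And>x. norm (f' x) \<le> K / (1 + x\<^sup>2)"
      "\<And>x. norm (f'' x) \<le> K / (1 + x\<^sup>2)"
    and "h > 0"
  shows "(\<lambda>m::int. f (m * h)) summable_on UNIV"
    and "((\<lambda>l::int. fourier f (2 * pi * l / h)) has_sum h *\<^sub>R (\<Sum>\<^sub>\<infinity>m::int. f (m * h))) UNIV"
proof -
  have "K \<ge> 0"
    using order_trans[OF norm_ge_zero bound(1)[of 0]] by simp
  define F F' F'' where "F x = f (x * h)" and "F' x = h *\<^sub>R f' (x * h)" and "F'' x = h *\<^sub>R (h *\<^sub>R f'' (x * h))" for x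
  have "h\<^sup>2 > 0" using \<open>h > 0\<close> by simp
  \<comment> \<open>Differentiating x -> f(x h) up to twice produces factors 1, h, h^2, all at most
    1 + h + h^2; the remaining factor is the loss from rescaling the weight.\<close>
  define C where "C = (1 + h + h\<^sup>2) * (K * (1 + 1 / h\<^sup>2))"
  have scale: "norm (c *\<^sub>R p (x * h)) \<le> C / (1 + x\<^sup>2)"
    if p: "\<And>x. norm (p x :: complex) \<le> K / (1 + x\<^sup>2)" and c: "0 \<le> c" "c \<le> 1 + h + h\<^sup>2" for p c x
  proof -
    have "norm (p (x * h)) \<le> K * (1 / (1 + (x * h)\<^sup>2))"
      using p by simp
    also have "\<dots> \<le> K * ((1 + 1 / h\<^sup>2) / (1 + x\<^sup>2))"
      by (intro mult_left_mono recip_1_plus_square_scale \<open>h > 0\<close> \<open>K \<ge> 0\<close>)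
    finally have "c * norm (p (x * h)) \<le> (1 + h + h\<^sup>2) * (K * ((1 + 1 / h\<^sup>2) / (1 + x\<^sup>2)))"
      using c by (intro mult_mono) auto
    then show ?thesis
      using c by (simp add: C_def)
  qed
  have chain: "((\<lambda>x. p (x * h)) has_vector_derivative h *\<^sub>R p' (x * h)) (at x)"
    if "\<And>x. (p has_vector_derivative p' x) (at x)" for p p' :: "real \<Rightarrow> complex" and x
  proof -
    have "((\<lambda>x. x * h) has_vector_derivative h) (at x)"
      by (auto intro!: derivative_eq_intros simp: has_real_derivative_iff_has_vector_derivative[symmetric])
    from vector_diff_chain_at[OF this that] show ?thesis
      by (simp add: o_def)
  qed
  have 1: "(F has_vector_derivative F' x) (at x)" "(F' has_vector_derivative F'' x) (at x)" for x
    unfolding F_def F'_def F''_def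
    by (intro chain deriv bounded_linear.has_vector_derivative[OF bounded_linear_scaleR_right])+
  have 2: "continuous_on UNIV F''"
    unfolding F''_def by (intro continuous_intros continuous_on_compose2[OF cont]) auto
  have 3: "norm (F x) \<le> C / (1 + x\<^sup>2)" "norm (F' x) \<le> C / (1 + x\<^sup>2)" "norm (F'' x) \<le> C / (1 + x\<^sup>2)" for x
    unfolding F_def F'_def F''_def
    using scale[OF bound(1), of 1 x] scale[OF bound(2), of h x] scale[OF bound(3), of "h\<^sup>2" x] \<open>h > 0\<close> \<open>h\<^sup>2 > 0\<close>
    by (auto simp: power2_eq_square)
  note unit = Poisson_summation_unit[OF 1 2 3]
  show "(\<lambda>m::int. f (m * h)) summable_on UNIV"
    using unit(1) by (simp add: F_def)
  have "fourier f (\<xi> / h) = h *\<^sub>R fourier F \<xi>" for \<xi>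
    using lborel_integral_real_affine[of h "\<lambda>x. f x * cis (- (\<xi> / h * x))" 0] \<open>h > 0\<close>
    by (simp add: fourier_def F_def mult.commute)
  moreover have sum_eq: "(\<Sum>\<^sub>\<infinity>m::int. F m) = (\<Sum>\<^sub>\<infinity>m::int. f (m * h))"
    by (simp add: F_def)
  ultimately show "((\<lambda>l::int. fourier f (2 * pi * l / h)) has_sum h *\<^sub>R (\<Sum>\<^sub>\<infinity>m::int. f (m * h))) UNIV"
    using has_sum_scaleR[OF unit(2), of h] unfolding sum_eq by simp
qed

section \<open>Holomorphic functions with quadratic decay in a strip\<close>

definition strip :: "complex set" where "strip = {z. \<bar>Im z\<bar> < 1 / 2}"

lemma open_strip: "open strip"
  unfolding strip_def by (intro open_Collect_less continuous_intros)

lemma of_real_in_strip [simp]: "of_real x \<in> strip"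
  by (simp add: strip_def)

text \<open>Cauchy's inequality on the circle of radius 1/4, which stays inside the strip and along
  which the weight loses at most a factor 2. The constant is the worst case n = 2, namely 64 = 2 *
  2! * 4^2.\<close>

lemma strip_decay_deriv_bound:
  assumes hol: "F holomorphic_on strip"
    and bound: "\<And>z. z \<in> strip \<Longrightarrow> norm (F z) \<le> K / (1 + (Re z)\<^sup>2)"
    and "n \<le> 2"
  shows "norm ((deriv ^^ n) F (of_real x)) \<le> 64 * K / (1 + x\<^sup>2)"
proof -
  have "K \<ge> 0"
    using order_trans[OF norm_ge_zero bound[of 0]] by (simp add: strip_def)
  have sub: "cball (of_real x) (1 / 4) \<subseteq> strip"
  proof
    fix w :: complex assume "w \<in> cball (of_real x) (1 / 4)"
    then have "\<bar>Im w\<bar> \<le> 1 / 4"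
      using abs_Im_le_cmod[of "of_real x - w"] by (simp add: dist_norm)
    then show "w \<in> strip" by (simp add: strip_def)
  qed
  have "norm ((deriv ^^ n) F (of_real x)) \<le> fact n * (2 * K / (1 + x\<^sup>2)) / (1 / 4) ^ n"
  proof (rule Cauchy_inequality)
    show "F holomorphic_on ball (complex_of_real x) (1 / 4)"
      using hol sub ball_subset_cball by (blast intro: holomorphic_on_subset)
    show "continuous_on (cball (complex_of_real x) (1 / 4)) F"
      using hol sub by (blast intro: holomorphic_on_imp_continuous_on holomorphic_on_subset)
    fix w assume w: "norm (complex_of_real x - w) = 1 / 4"
    have "\<bar>Re w - x\<bar> \<le> 1 / 4"
      using abs_Re_le_cmod[of "of_real x - w"] w by (simp add: abs_minus_commute)
    then have "(Re w - x)\<^sup>2 \<le> (1 / 4)\<^sup>2"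
      by (simp only: abs_le_square_iff[symmetric])
    \<comment> \<open>The difference of the two sides is the square of 2 Re w - x.\<close>
    moreover have "x\<^sup>2 \<le> 2 * (Re w)\<^sup>2 + 2 * (Re w - x)\<^sup>2"
      using zero_le_power2[of "2 * Re w - x"] by (simp add: power2_eq_square algebra_simps)
    ultimately have "1 + x\<^sup>2 \<le> 2 * (1 + (Re w)\<^sup>2)"
      by (simp add: power2_eq_square)
    then have "K * (1 + x\<^sup>2) \<le> K * (2 * (1 + (Re w)\<^sup>2))"
      using \<open>K \<ge> 0\<close> by (rule mult_left_mono)
    then have "K / (1 + (Re w)\<^sup>2) \<le> 2 * K / (1 + x\<^sup>2)"
      by (simp add: frac_le_eq divide_le_eq field_simps add_pos_nonneg)
    moreover have "w \<in> strip"
      using sub w by (auto simp: dist_norm)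
    ultimately show "norm (F w) \<le> 2 * K / (1 + x\<^sup>2)"
      using bound by (blast intro: order_trans)
  qed simp
  also have "fact n * (2 * K / (1 + x\<^sup>2)) / (1 / 4) ^ n = (2 * fact n * 4 ^ n) * (K / (1 + x\<^sup>2))"
    by (simp add: field_simps)
  also have "\<dots> \<le> 64 * (K / (1 + x\<^sup>2))"
  proof (rule mult_right_mono)
    consider "n = 0" | "n = 1" | "n = 2" using \<open>n \<le> 2\<close> by linarith
    then show "2 * fact n * 4 ^ n \<le> (64::real)"
      by cases (auto simp: fact_2)
  qed (use \<open>K \<ge> 0\<close> in simp)
  finally show ?thesis by simp
qed

theorem Poisson_summation_strip:
  assumes hol: "F holomorphic_on strip"
    and bound: "\<And>z. z \<in> strip \<Longrightarrow> norm (F z) \<le> K / (1 + (Re z)\<^sup>2)"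
    and "h > 0"
  defines "f \<equiv> \<lambda>x. F (of_real x)"
  shows "\<And>\<xi>. integrable lborel (\<lambda>x. f x * cis (- (\<xi> * x)))"
    and "(\<lambda>m::int. f (m * h)) summable_on UNIV"
    and "((\<lambda>l::int. fourier f (2 * pi * l / h)) has_sum h *\<^sub>R (\<Sum>\<^sub>\<infinity>m::int. f (m * h))) UNIV"
proof -
  define D where "D n x = (deriv ^^ n) F (of_real x)" for n and x :: real
  have holD: "(deriv ^^ n) F holomorphic_on strip" for n
    using hol by (intro holomorphic_higher_deriv open_strip)
  have derivD: "(D n has_vector_derivative D (Suc n) x) (at x)" for n x
  proof -
    have "((deriv ^^ n) F has_field_derivative (deriv ^^ Suc n) F (of_real x)) (at (of_real x))"
      using holomorphic_derivI[OF holD open_strip of_real_in_strip] by simp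
    then show ?thesis
      unfolding D_def by (rule has_vector_derivative_real_field)
  qed
  have contD: "continuous_on UNIV (D n)" for n
    by (meson continuous_at_imp_continuous_on derivD has_vector_derivative_continuous)
  have boundD: "norm (D n x) \<le> 64 * K / (1 + x\<^sup>2)" if "n \<le> 2" for n x
    unfolding D_def by (rule strip_decay_deriv_bound[OF hol bound that])
  have f: "f = D 0" by (simp add: f_def D_def fun_eq_iff)
  show "\<And>\<xi>. integrable lborel (\<lambda>x. f x * cis (- (\<xi> * x)))"
    unfolding f by (rule integrable_fourier[OF contD boundD]) simp
  note P = Poisson_summation[OF derivD derivD contD boundD boundD boundD \<open>h > 0\<close>, of 0, folded f]
  show "(\<lambda>m::int. f (m * h)) summable_on UNIV"
    by (rule P) auto
  show "((\<lambda>l::int. fourier f (2 * pi * l / h)) has_sum h *\<^sub>R (\<Sum>\<^sub>\<infinity>m::int. f (m * h))) UNIV"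
    by (rule P) auto
qed

section \<open>Entries of matrices and of the matrix exponential\<close>

lemma sums_vecI:
  fixes f :: "nat \<Rightarrow> 'a::real_normed_vector ^ 'n"
  assumes "\<And>i. (\<lambda>n. f n $ i) sums (s $ i)"
  shows "f sums s"
  using assms unfolding sums_def by (intro vec_tendstoI) simp

lemma has_sum_vecI:
  fixes f :: "'i \<Rightarrow> 'a::real_normed_vector ^ 'n"
  assumes "\<And>i. ((\<lambda>x. f x $ i) has_sum s $ i) A"
  shows "(f has_sum s) A"
  using assms unfolding has_sum_def by (intro vec_tendstoI) simp

text \<open>A vector is the sum of its coordinates embedded by the bounded linear maps
  \<open>axis i\<close>, which commute with the integral. Two applications reach the entries of a
  matrix.\<close>

lemma has_bochner_integral_vecI:
  fixes f :: "'b \<Rightarrow> 'a::euclidean_space ^ 'n"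
  assumes "\<And>i. has_bochner_integral M (\<lambda>x. f x $ i) (s $ i)"
  shows "has_bochner_integral M f s"
proof -
  have expand: "v = (\<Sum>i\<in>UNIV. axis i (v $ i))" for v :: "'a ^ 'n"
    by (simp add: vec_eq_iff axis_def)
  have "bounded_linear (axis i :: 'a \<Rightarrow> 'a ^ 'n)" for i
    unfolding linear_conv_bounded_linear[symmetric]
    by (rule linearI) (auto simp: vec_eq_iff axis_def)
  then have "has_bochner_integral M (\<lambda>x. \<Sum>i\<in>UNIV. axis i (f x $ i)) (\<Sum>i\<in>UNIV. axis i (s $ i))"
    by (rule has_bochner_integral_sum[OF has_bochner_integral_bounded_linear[OF _ assms]])
  moreover have "(\<lambda>x. \<Sum>i\<in>UNIV. axis i (f x $ i)) = f"
    by (rule ext) (rule expand[symmetric])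
  ultimately show ?thesis
    by (simp only: expand[of s, symmetric])
qed

section \<open>Operator norm and convergence\<close>

lemma matrix_vector_mult_norm_le:
  fixes A :: "complex^'n^'m"
  shows "norm (A *v v) \<le> (\<Sum>i\<in>UNIV. norm (A $ i)) * (CARD('n) * norm v)"
proof -
  have "norm ((A *v v) $ i) \<le> norm (A $ i) * (CARD('n) * norm v)" for i
  proof -
    have "norm ((A *v v) $ i) \<le> (\<Sum>j\<in>UNIV. norm (A $ i $ j * v $ j))"
      unfolding matrix_vector_mult_def by (simp add: norm_sum)
    also have "\<dots> \<le> (\<Sum>j\<in>(UNIV::'n set). norm (A $ i) * norm v)"
      by (intro sum_mono) (simp add: norm_mult mult_mono component_le_norm_cart Finite_Cartesian_Product.norm_nth_le)
    finally show ?thesis by (simp add: mult_ac)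
  qed
  then have "(\<Sum>i\<in>UNIV. norm ((A *v v) $ i)) \<le> (\<Sum>i\<in>UNIV. norm (A $ i) * (CARD('n) * norm v))"
    by (intro sum_mono)
  moreover have "norm (A *v v) \<le> (\<Sum>i\<in>UNIV. norm ((A *v v) $ i))"
    unfolding norm_vec_def by (intro L2_set_le_sum) simp
  ultimately show ?thesis
    by (simp add: sum_distrib_right)
qed

lemma norm_matrix_entry_le: "norm (A $ i $ j) \<le> norm A"
  by (rule order_trans[OF Finite_Cartesian_Product.norm_nth_le Finite_Cartesian_Product.norm_nth_le])

lemma op_norm_bounds:
  fixes A :: "complex^'n^'n"
  shows "0 \<le> op_norm A" "op_norm A \<le> (\<Sum>i\<in>UNIV. norm (A $ i)) * CARD('n)"
proof -
  have "bounded_linear (\<lambda>v. A *v v)"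
    by (rule bounded_linear_intro[of _ "(\<Sum>i\<in>UNIV. norm (A $ i)) * CARD('n)"])
       (use matrix_vector_mult_norm_le[of A] in
         \<open>auto simp: vec_eq_iff matrix_vector_mult_def scaleR_sum_right distrib_left sum.distrib mult_ac\<close>)
  then show "0 \<le> op_norm A"
    unfolding op_norm_def by (rule onorm_pos_le)
  show "op_norm A \<le> (\<Sum>i\<in>UNIV. norm (A $ i)) * CARD('n)"
    unfolding op_norm_def by (rule onorm_le) (use matrix_vector_mult_norm_le[of A] in \<open>simp add: mult.assoc\<close>)
qed

text \<open>A crude comparison suffices: the operator norm is squeezed between 0 and a multiple of
  the sum of the row norms, which is continuous and vanishes at the zero matrix.\<close>

lemma op_norm_summable_if_summable_on:
  fixes f :: "'i \<Rightarrow> complex^'n^'n"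
  assumes "f summable_on I"
  shows "op_norm_summable f I"
  unfolding op_norm_summable_def
proof (rule tendsto_sandwich[OF always_eventually always_eventually tendsto_const])
  let ?D = "\<lambda>F. sum f F - infsum f I"
  have "(sum f \<longlongrightarrow> infsum f I) (finite_subsets_at_top I)"
    using has_sum_infsum[OF assms] by (simp add: has_sum_def)
  then have "(?D \<longlongrightarrow> 0) (finite_subsets_at_top I)"
    by (simp add: LIM_zero)
  then have "((\<lambda>F. (\<Sum>i\<in>UNIV. norm (?D F $ i)) * CARD('n)) \<longlongrightarrow> (\<Sum>i\<in>UNIV. norm ((0::complex^'n^'n) $ i)) * CARD('n)) (finite_subsets_at_top I)"
    by (intro tendsto_intros)
  then show "((\<lambda>F. (\<Sum>i\<in>UNIV. norm (?D F $ i)) * CARD('n)) \<longlongrightarrow> 0) (finite_subsets_at_top I)"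
    by simp
  show "\<forall>F. op_norm (?D F) \<le> (\<Sum>i\<in>UNIV. norm (?D F $ i)) * CARD('n)"
    by (intro allI op_norm_bounds)
qed (intro allI op_norm_bounds)

section \<open>Entries of matrix powers and of the exponential\<close>

lemma norm_mpow_entry_le:
  fixes A :: "complex^'n^'n" and b :: real
  assumes "\<And>i j. norm (A $ i $ j) \<le> b"
  shows "norm (mpow A n $ i $ j) \<le> (CARD('n) * b) ^ n"
proof (induction n arbitrary: i j)
  case 0
  then show ?case by (simp add: mat_def)
next
  case (Suc n)
  have "b \<ge> 0" using assms norm_ge_zero order_trans by blast
  have "norm (mpow A (Suc n) $ i $ j) \<le> (\<Sum>k\<in>UNIV. norm (A $ i $ k * mpow A n $ k $ j))"
    by (simp add: matrix_matrix_mult_def norm_sum)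
  also have "\<dots> \<le> (\<Sum>k\<in>(UNIV::'n set). b * (CARD('n) * b) ^ n)"
    using \<open>b \<ge> 0\<close> by (intro sum_mono) (auto simp: norm_mult intro!: mult_mono assms Suc.IH)
  finally show ?case by (simp add: mult_ac)
qed

lemma norm_mexp_term_entry_le:
  fixes A :: "complex^'n^'n" and b :: real
  assumes "\<And>i j. norm (A $ i $ j) \<le> b"
  shows "norm (((1 / fact n) *\<^sub>R mpow A n) $ i $ j) \<le> inverse (fact n) * (CARD('n) * b) ^ n"
  using mult_left_mono[OF norm_mpow_entry_le[OF assms], of "inverse (fact n)"]
  by (simp add: inverse_eq_divide)

text \<open>Certifies that the \<open>suminf\<close> defining \<open>mexp\<close> is a genuine
  limit: each entry is dominated by a scalar exponential series.\<close>

lemma mexp_entry_sums: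
  fixes A :: "complex^'n^'n"
  shows "(\<lambda>n. ((1 / fact n) *\<^sub>R mpow A n) $ i $ j) sums mexp A $ i $ j"
proof -
  have "summable (\<lambda>n. ((1 / fact n) *\<^sub>R mpow A n) $ i $ j)" for i j
    by (rule summable_comparison_test'[OF summable_exp norm_mexp_term_entry_le[OF norm_matrix_entry_le]])
  then have "(\<lambda>n. (1 / fact n) *\<^sub>R mpow A n) sums (\<chi> i j. \<Sum>n. ((1 / fact n) *\<^sub>R mpow A n) $ i $ j)"
    by (intro sums_vecI) (simp add: summable_sums)
  then have "(\<lambda>n. (1 / fact n) *\<^sub>R mpow A n) sums mexp A"
    unfolding mexp_def by (simp add: sums_iff)
  then show ?thesis
    by (intro sums_vec_nth)
qed

lemma norm_mexp_entry_le:
  fixes A :: "complex^'n^'n" and b :: real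
  assumes "\<And>i j. norm (A $ i $ j) \<le> b"
  shows "norm (mexp A $ i $ j) \<le> exp (CARD('n) * b)"
proof -
  have "norm (\<Sum>n. ((1 / fact n) *\<^sub>R mpow A n) $ i $ j) \<le> (\<Sum>n. inverse (fact n) * (CARD('n) * b) ^ n)"
    by (rule norm_suminf_le[OF norm_mexp_term_entry_le[OF assms] summable_exp])
  then show ?thesis
    using sums_unique[OF mexp_entry_sums[of A i j]] by (simp add: exp_def divide_inverse mult.commute)
qed

text \<open>The partial sums are polynomials in the entries of \<open>A z\<close>, and they converge
  uniformly on small closed discs, so the limit inherits holomorphy.\<close>

lemma holomorphic_mexp_entry:
  fixes A :: "complex \<Rightarrow> complex^'n^'n"
  assumes "open S" and hol: "\<And>i j. (\<lambda>z. A z $ i $ j) holomorphic_on S"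
  shows "(\<lambda>z. mexp (A z) $ i $ j) holomorphic_on S"
proof (rule holomorphic_uniform_sequence[OF \<open>open S\<close>])
  have "(\<lambda>z. mpow (A z) n $ i $ j) holomorphic_on S" for n i j
  proof (induction n arbitrary: i j)
    case (Suc n)
    then show ?case
      by (simp add: matrix_matrix_mult_def) (intro holomorphic_intros hol Suc)
  qed simp
  then show "(\<lambda>z. \<Sum>n<N. ((1 / fact n) *\<^sub>R mpow (A z) n) $ i $ j) holomorphic_on S" for N
    by (simp add: scaleR_conv_of_real) (intro holomorphic_intros)
  fix x assume "x \<in> S"
  then obtain d where d: "d > 0" "cball x d \<subseteq> S"
    using \<open>open S\<close> open_contains_cball by blast
  have "\<exists>b. \<forall>z\<in>cball x d. norm (A z $ i $ j) \<le> b" for i j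
  proof -
    have "continuous_on (cball x d) (\<lambda>z. A z $ i $ j)"
      using hol d by (blast intro: holomorphic_on_imp_continuous_on holomorphic_on_subset)
    from compact_imp_bounded[OF compact_continuous_image[OF this compact_cball]] show ?thesis
      by (simp add: bounded_iff)
  qed
  then obtain b where b: "\<And>i j z. z \<in> cball x d \<Longrightarrow> norm (A z $ i $ j) \<le> b i j"
    by metis
  \<comment> \<open>An entry of a power mixes all entries of the matrix, so the majorant needs one
    bound common to all of them.\<close>
  define B where "B = (\<Sum>i\<in>UNIV. \<Sum>j\<in>UNIV. \<bar>b i j\<bar>)"
  have B: "norm (A z $ i $ j) \<le> B" if "z \<in> cball x d" for z i j
  proof -
    have "norm (A z $ i $ j) \<le> \<bar>b i j\<bar>" using b[OF that, of i j] by linarith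
    also have "\<dots> \<le> (\<Sum>j\<in>UNIV. \<bar>b i j\<bar>)" by (rule member_le_sum) auto
    also have "\<dots> \<le> B" unfolding B_def by (rule member_le_sum) (auto intro: sum_nonneg)
    finally show ?thesis .
  qed
  have "uniform_limit (cball x d) (\<lambda>N z. \<Sum>n<N. ((1 / fact n) *\<^sub>R mpow (A z) n) $ i $ j)
      (\<lambda>z. \<Sum>n. ((1 / fact n) *\<^sub>R mpow (A z) n) $ i $ j) sequentially"
    by (rule Weierstrass_m_test[OF norm_mexp_term_entry_le[OF B] summable_exp])
  then have "uniform_limit (cball x d) (\<lambda>N z. \<Sum>n<N. ((1 / fact n) *\<^sub>R mpow (A z) n) $ i $ j)
      (\<lambda>z. mexp (A z) $ i $ j) sequentially"
    by (simp only: sums_unique[OF mexp_entry_sums, symmetric])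
  with d show "\<exists>d. 0 < d \<and> cball x d \<subseteq> S \<and>
      uniform_limit (cball x d) (\<lambda>N z. \<Sum>n<N. ((1 / fact n) *\<^sub>R mpow (A z) n) $ i $ j) (\<lambda>z. mexp (A z) $ i $ j) sequentially"
    by blast
qed

section \<open>Decay of the two integrands in the strip\<close>

definition evol_complex :: "real \<Rightarrow> complex^'n^'n \<Rightarrow> complex^'n^'n \<Rightarrow> complex \<Rightarrow> complex^'n^'n"
  where "evol_complex T L G z = mexp ((- \<i> * complex_of_real T) *\<^sub>M (z *\<^sub>M L + G))"

definition q_complex :: "real \<Rightarrow> real \<Rightarrow> complex \<Rightarrow> complex"
  where "q_complex c \<gamma> z =
    exp (of_real c - \<i> * of_real c * z) / (of_real pi * (1 + z\<^sup>2)) * exp (- ((z\<^sup>2 + 1) / of_real (4 * \<gamma>\<^sup>2)))"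

lemma evol_eq_evol_complex: "evol T L G k = evol_complex T L G (of_real k)"
proof -
  have "k *\<^sub>R L = of_real k *\<^sub>M L"
    by (simp add: vec_eq_iff cscale_def map_matrix_def scaleR_conv_of_real[symmetric])
  then show ?thesis by (simp add: evol_def evol_complex_def)
qed

lemma q_kernel_eq_q_complex: "q_kernel c \<gamma> k = q_complex c \<gamma> (of_real k)"
  by (simp add: q_kernel_def q_complex_def exp_of_real[symmetric] mult_ac)

lemma cscale_entry [simp]: "(z *\<^sub>M A) $ i $ j = z * A $ i $ j"
  by (simp add: cscale_def map_matrix_def)

lemma holomorphic_evol_complex: "(\<lambda>z. evol_complex T L G z $ i $ j) holomorphic_on UNIV"
  unfolding evol_complex_def by (intro holomorphic_mexp_entry) (auto intro!: holomorphic_intros)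

lemma norm_evol_complex_entry_le:
  fixes L G :: "complex^'n^'n"
  shows "norm (evol_complex T L G z $ i $ j) \<le> exp (CARD('n) * (\<bar>T\<bar> * (norm z * norm L + norm G)))"
  unfolding evol_complex_def
proof (rule norm_mexp_entry_le)
  fix i j :: 'n
  show "norm (((- \<i> * complex_of_real T) *\<^sub>M (z *\<^sub>M L + G)) $ i $ j) \<le> \<bar>T\<bar> * (norm z * norm L + norm G)"
    by (auto simp: norm_mult intro!: mult_left_mono norm_triangle_mono norm_matrix_entry_le)
qed

text \<open>The Taylor bound exp s \<ge> 1 + s + s^2/2 trades the weight 1 + s^2 for 2 exp s,
  raising the linear rate to B + 1; completing the square bounds what is left. It is applied with s
  = |Re z| and with s = cosh (Re z).\<close>

lemma gaussian_le_quadratic_decay: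
  fixes \<alpha> B s :: real
  assumes "\<alpha> > 0" "s \<ge> 0"
  shows "exp (B * s - \<alpha> * s\<^sup>2) \<le> 2 * exp ((B + 1)\<^sup>2 / (4 * \<alpha>)) / (1 + s\<^sup>2)"
proof -
  have "1 + s\<^sup>2 \<le> 2 * exp s"
    using exp_lower_Taylor_quadratic[OF \<open>s \<ge> 0\<close>] \<open>s \<ge> 0\<close> by simp
  then have "exp (B * s - \<alpha> * s\<^sup>2) * (1 + s\<^sup>2) \<le> exp (B * s - \<alpha> * s\<^sup>2) * (2 * exp s)"
    by (intro mult_left_mono) auto
  also have "\<dots> = 2 * exp ((B + 1) * s - \<alpha> * s\<^sup>2)"
    by (simp add: exp_add[symmetric] algebra_simps)
  also have "(B + 1) * s - \<alpha> * s\<^sup>2 \<le> (B + 1)\<^sup>2 / (4 * \<alpha>)"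
  proof -
    have "0 \<le> (2 * \<alpha> * s - (B + 1))\<^sup>2" by simp
    then have "4 * \<alpha> * ((B + 1) * s - \<alpha> * s\<^sup>2) \<le> (B + 1)\<^sup>2"
      by (simp add: power2_eq_square algebra_simps)
    then show ?thesis
      using \<open>\<alpha> > 0\<close> by (simp add: pos_le_divide_eq mult.commute)
  qed
  finally show ?thesis
    by (simp add: pos_le_divide_eq add_pos_nonneg)
qed

lemma norm_q_complex:
  "norm (q_complex c \<gamma> w)
     = exp (c + c * Im w) / (pi * norm (1 + w\<^sup>2)) * exp (- ((Re (w\<^sup>2) + 1) / (4 * \<gamma>\<^sup>2)))"
proof -
  have "Re ((w\<^sup>2 + 1) / complex_of_real (4 * \<gamma>\<^sup>2)) = (Re (w\<^sup>2) + 1) / (4 * \<gamma>\<^sup>2)"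
    by (simp only: Re_divide_of_real plus_complex.simps one_complex.simps)
  then show ?thesis
    by (simp add: q_complex_def norm_mult norm_divide norm_exp_eq_Re del: of_real_mult of_real_power)
qed

lemma holomorphic_q_complex:
  assumes "g holomorphic_on S" and "\<And>z. z \<in> S \<Longrightarrow> 1 + (g z)\<^sup>2 \<noteq> 0" and "\<gamma> > 0"
  shows "(\<lambda>z. q_complex c \<gamma> (g z)) holomorphic_on S"
  unfolding q_complex_def by (intro holomorphic_intros assms) (use assms in auto)

text \<open>Both follow from (Im z)^2 \<le> 1/4. The first preserves the Gaussian decay, the second
  keeps 1 + z^2 uniformly away from 0.\<close>

lemma Re_square_strip:
  assumes "z \<in> strip"
  shows "(Re z)\<^sup>2 \<le> Re (z\<^sup>2) + 1" "3 / 4 \<le> Re (z\<^sup>2) + 1"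
proof -
  have "(Im z)\<^sup>2 \<le> (1 / 2)\<^sup>2"
    using assms by (simp only: abs_le_square_iff[symmetric]) (simp add: strip_def)
  then have "(Im z)\<^sup>2 \<le> 1 / 4" by (simp add: power2_eq_square)
  then show "(Re z)\<^sup>2 \<le> Re (z\<^sup>2) + 1" "3 / 4 \<le> Re (z\<^sup>2) + 1"
    using zero_le_power2[of "Re z"] unfolding Re_power2 by linarith+
qed

lemma q_evol_strip_decay:
  fixes L G :: "complex^'n^'n"
  assumes "c > 0" "\<gamma> > 0"
  shows "\<exists>K. \<forall>z\<in>strip. norm (q_complex c \<gamma> z * evol_complex T L G z $ i $ j) \<le> K / (1 + (Re z)\<^sup>2)"
proof -
  define B C where "B = CARD('n) * (\<bar>T\<bar> * norm L)" and "C = CARD('n) * (\<bar>T\<bar> * norm G)"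
  define \<alpha> where "\<alpha> = 1 / (4 * \<gamma>\<^sup>2)"
  have "\<alpha> > 0" "B \<ge> 0" using assms by (auto simp: \<alpha>_def B_def)
  have "norm (q_complex c \<gamma> z * evol_complex T L G z $ i $ j)
      \<le> exp (2 * c + C + B) * (2 * exp ((B + 1)\<^sup>2 / (4 * \<alpha>))) / (1 + (Re z)\<^sup>2)"
    if z: "z \<in> strip" for z
  proof -
    have Im: "\<bar>Im z\<bar> \<le> 1" using z by (simp add: strip_def)
    have "3 / 4 \<le> norm (1 + z\<^sup>2)"
      using Re_square_strip(2)[OF z] complex_Re_le_cmod[of "1 + z\<^sup>2"] by simp
    then have "3 * (3 / 4) \<le> pi * norm (1 + z\<^sup>2)"
      using pi_gt3 by (intro mult_mono) auto
    then have "exp (c + c * Im z) / (pi * norm (1 + z\<^sup>2)) \<le> exp (c + c * Im z) / 1"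
      by (intro divide_left_mono) auto
    also have "\<dots> \<le> exp (2 * c)"
      using mult_left_mono[of "Im z" 1 c] Im \<open>c > 0\<close> by simp
    finally have 1: "exp (c + c * Im z) / (pi * norm (1 + z\<^sup>2)) \<le> exp (2 * c)" .
    have "\<alpha> * (Re z)\<^sup>2 \<le> \<alpha> * (Re (z\<^sup>2) + 1)"
      using Re_square_strip(1)[OF z] \<open>\<alpha> > 0\<close> by (intro mult_left_mono) auto
    then have 2: "exp (- ((Re (z\<^sup>2) + 1) / (4 * \<gamma>\<^sup>2))) \<le> exp (- \<alpha> * (Re z)\<^sup>2)"
      by (simp add: \<alpha>_def)
    have "norm z \<le> \<bar>Re z\<bar> + 1"
      using cmod_le[of z] Im by linarith
    then have "B * norm z \<le> B * (\<bar>Re z\<bar> + 1)"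
      using \<open>B \<ge> 0\<close> by (rule mult_left_mono)
    then have 3: "norm (evol_complex T L G z $ i $ j) \<le> exp (B * \<bar>Re z\<bar> + B + C)"
      by (intro order_trans[OF norm_evol_complex_entry_le]) (simp add: B_def C_def algebra_simps)
    have "norm (q_complex c \<gamma> z * evol_complex T L G z $ i $ j)
        \<le> (exp (2 * c) * exp (- \<alpha> * (Re z)\<^sup>2)) * exp (B * \<bar>Re z\<bar> + B + C)"
      unfolding norm_mult norm_q_complex by (intro mult_mono 1 2 3) auto
    also have "\<dots> = exp (2 * c + C + B) * exp (B * \<bar>Re z\<bar> - \<alpha> * \<bar>Re z\<bar>\<^sup>2)"
      by (simp add: exp_add[symmetric] algebra_simps)
    also have "\<dots> \<le> exp (2 * c + C + B) * (2 * exp ((B + 1)\<^sup>2 / (4 * \<alpha>)) / (1 + \<bar>Re z\<bar>\<^sup>2))"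
      by (intro mult_left_mono gaussian_le_quadratic_decay \<open>\<alpha> > 0\<close>) auto
    finally show ?thesis by simp
  qed
  then show ?thesis by blast
qed

section \<open>The hyperbolic substitution in the strip\<close>

lemma cosh_sinh_complex:
  "cosh z = Complex (cosh (Re z) * cos (Im z)) (sinh (Re z) * sin (Im z))"
  "sinh z = Complex (sinh (Re z) * cos (Im z)) (cosh (Re z) * sin (Im z))"
  by (simp_all add: complex_eq_iff cosh_def sinh_def Re_exp Im_exp field_simps)

lemma cosh_sinh_of_real:
  "cosh (complex_of_real x) = of_real (cosh x)" "sinh (complex_of_real x) = of_real (sinh x)"
  by (simp_all add: cosh_sinh_complex complex_eq_iff)

lemma norm_sinh_le_cosh_Re: "norm (sinh z :: complex) \<le> cosh (Re z)"
proof -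
  have "(norm (sinh z))\<^sup>2 = (sinh (Re z))\<^sup>2 * (cos (Im z))\<^sup>2 + (cosh (Re z))\<^sup>2 * (sin (Im z))\<^sup>2"
    by (simp add: cosh_sinh_complex cmod_power2 power_mult_distrib)
  also have "\<dots> \<le> (cosh (Re z))\<^sup>2 * (cos (Im z))\<^sup>2 + (cosh (Re z))\<^sup>2 * (sin (Im z))\<^sup>2"
    by (intro add_right_mono mult_right_mono) (auto simp: sinh_square_eq)
  also have "\<dots> = (cosh (Re z))\<^sup>2"
    by (simp add: distrib_left[symmetric])
  finally show ?thesis
    by (rule power2_le_imp_le) simp
qed

lemma abs_le_cosh: "\<bar>x\<bar> \<le> cosh (x::real)"
proof -
  have "\<bar>x\<bar> \<le> exp \<bar>x\<bar> / 2"
    using exp_lower_Taylor_quadratic[of "\<bar>x\<bar>"] zero_le_power2[of "\<bar>x\<bar> - 1"]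
    by (simp add: power2_eq_square algebra_simps)
  also have "\<dots> \<le> cosh \<bar>x\<bar>"
    by (simp add: cosh_def)
  finally show ?thesis by simp
qed

text \<open>Since |sin (Im z)| \<le> 1/2, the factor 1 - 2 sin^2 = cos (2 Im z) is at least 1/2. As
  (cosh z)^2 = 1 + (sinh z)^2, this controls the denominator and the Gaussian of the transformed
  kernel together.\<close>

lemma Re_cosh_square_strip:
  assumes "z \<in> strip"
  shows "(cosh (Re z))\<^sup>2 / 2 \<le> Re ((cosh z)\<^sup>2)"
proof -
  have "\<bar>sin (Im z)\<bar> \<le> \<bar>1 / 2\<bar>"
    using abs_sin_x_le_abs_x[of "Im z"] assms by (simp add: strip_def)
  then have "(sin (Im z))\<^sup>2 \<le> (1 / 2)\<^sup>2"
    by (simp only: abs_le_square_iff)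
  then have sin: "(sin (Im z))\<^sup>2 \<le> 1 / 4" by (simp add: power2_eq_square)
  have "Re ((cosh z)\<^sup>2) = (cosh (Re z))\<^sup>2 * (1 - 2 * (sin (Im z))\<^sup>2) + (sin (Im z))\<^sup>2"
    by (simp add: cosh_sinh_complex Re_power2 power_mult_distrib cos_squared_eq sinh_square_eq algebra_simps)
  moreover have "(cosh (Re z))\<^sup>2 * (1 / 2) \<le> (cosh (Re z))\<^sup>2 * (1 - 2 * (sin (Im z))\<^sup>2)"
    using sin by (intro mult_left_mono) auto
  ultimately show ?thesis
    using zero_le_power2[of "sin (Im z)"] by linarith
qed

text \<open>All growth is measured in t = cosh (Re z). Unlike before, the imaginary part of the
  kernel's argument can grow like t, so exp (c Im (sinh z)) is no longer bounded; its rate c joins B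
  in the linear exponent, and the term in t^2 still dominates.\<close>

lemma cosh_q_evol_sinh_strip_decay:
  fixes L G :: "complex^'n^'n"
  assumes "c > 0" "\<gamma> > 0"
  shows "\<exists>K. \<forall>z\<in>strip. norm (cosh z * q_complex c \<gamma> (sinh z) * evol_complex T L G (sinh z) $ i $ j)
           \<le> K / (1 + (Re z)\<^sup>2)"
proof -
  define B C where "B = CARD('n) * (\<bar>T\<bar> * norm L)" and "C = CARD('n) * (\<bar>T\<bar> * norm G)"
  \<comment> \<open>Half of 1 / (4 \<gamma>^2), because the real part of (cosh z)^2 is only known to
    be at least t^2/2.\<close>
  define \<alpha> where "\<alpha> = 1 / (8 * \<gamma>\<^sup>2)"
  have "\<alpha> > 0" "B \<ge> 0" using assms by (auto simp: \<alpha>_def B_def)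
  let ?K = "exp (c + C) * (2 * exp ((B + c + 1)\<^sup>2 / (4 * \<alpha>)))"
  have "norm (cosh z * q_complex c \<gamma> (sinh z) * evol_complex T L G (sinh z) $ i $ j) \<le> ?K / (1 + (Re z)\<^sup>2)"
    if z: "z \<in> strip" for z
  proof -
    define t where "t = cosh (Re z)"
    have t: "t \<ge> 1" by (simp add: t_def cosh_real_ge_1)
    have sq: "1 + (sinh z)\<^sup>2 = (cosh z)\<^sup>2"
      by (simp add: cosh_square_eq)
    have Re: "t\<^sup>2 / 2 \<le> Re ((cosh z)\<^sup>2)"
      unfolding t_def by (rule Re_cosh_square_strip[OF z])
    have "1 / 2 \<le> norm (cosh z)"
    proof -
      have "(1 / 2)\<^sup>2 \<le> t\<^sup>2 / 2" using one_le_power[OF t, of 2] by (simp add: power2_eq_square)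
      also have "\<dots> \<le> (norm (cosh z))\<^sup>2"
        using Re complex_Re_le_cmod[of "(cosh z)\<^sup>2"] by (simp add: norm_power)
      finally show ?thesis by (rule power2_le_imp_le) simp
    qed
    then have "3 * (1 / 2) \<le> pi * norm (cosh z)"
      using pi_gt3 by (intro mult_mono) auto
    then have 0: "1 / (pi * norm (cosh z)) \<le> 1" by simp
    have "c * Im (sinh z) \<le> c * t"
      using abs_Im_le_cmod[of "sinh z"] norm_sinh_le_cosh_Re[of z] \<open>c > 0\<close>
      by (intro mult_left_mono) (auto simp: t_def)
    then have 1: "exp (c + c * Im (sinh z)) \<le> exp (c + c * t)" by simp
    have "Re ((sinh z)\<^sup>2) + 1 = Re ((cosh z)\<^sup>2)"
      by (simp flip: sq)
    then have "\<alpha> * t\<^sup>2 \<le> (Re ((sinh z)\<^sup>2) + 1) / (4 * \<gamma>\<^sup>2)"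
      using divide_right_mono[OF Re, of "4 * \<gamma>\<^sup>2"] by (simp add: \<alpha>_def)
    then have 2: "exp (- ((Re ((sinh z)\<^sup>2) + 1) / (4 * \<gamma>\<^sup>2))) \<le> exp (- \<alpha> * t\<^sup>2)" by simp
    have "B * norm (sinh z) \<le> B * t"
      unfolding t_def by (intro mult_left_mono norm_sinh_le_cosh_Re \<open>B \<ge> 0\<close>)
    then have 3: "norm (evol_complex T L G (sinh z) $ i $ j) \<le> exp (B * t + C)"
      by (intro order_trans[OF norm_evol_complex_entry_le]) (simp add: B_def C_def algebra_simps)
    \<comment> \<open>The Jacobian cosh z cancels one of the two factors in 1 + (sinh z)^2 = (cosh
      z)^2, leaving 1 / (pi |cosh z|).\<close>
    have "norm (cosh z * q_complex c \<gamma> (sinh z) * evol_complex T L G (sinh z) $ i $ j)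
        = (1 / (pi * norm (cosh z))) * exp (c + c * Im (sinh z))
          * exp (- ((Re ((sinh z)\<^sup>2) + 1) / (4 * \<gamma>\<^sup>2))) * norm (evol_complex T L G (sinh z) $ i $ j)"
      unfolding norm_mult norm_q_complex sq norm_power using \<open>1 / 2 \<le> norm (cosh z)\<close>
      by (simp add: power2_eq_square field_simps)
    also have "\<dots> \<le> 1 * exp (c + c * t) * exp (- \<alpha> * t\<^sup>2) * exp (B * t + C)"
      by (intro mult_mono 0 1 2 3) auto
    also have "\<dots> = exp (c + C) * exp ((B + c) * t - \<alpha> * t\<^sup>2)"
      by (simp add: exp_add[symmetric] algebra_simps)
    also have "\<dots> \<le> exp (c + C) * (2 * exp ((B + c + 1)\<^sup>2 / (4 * \<alpha>)) / (1 + t\<^sup>2))"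
      using t by (intro mult_left_mono gaussian_le_quadratic_decay \<open>\<alpha> > 0\<close>) auto
    also have "\<dots> = ?K / (1 + t\<^sup>2)" by simp
    also have "\<dots> \<le> ?K / (1 + (Re z)\<^sup>2)"
    proof (rule divide_left_mono)
      show "1 + (Re z)\<^sup>2 \<le> 1 + t\<^sup>2"
        using power_mono[OF abs_le_cosh[of "Re z"], of 2] by (simp add: t_def)
    qed (auto intro!: mult_pos_pos add_pos_nonneg)
    finally show ?thesis .
  qed
  then show ?thesis by blast
qed

section \<open>The Weyl-Poisson identity\<close>

lemma matrix_Poisson_summation:
  fixes A :: "real \<Rightarrow> complex^'n^'n" and F :: "'n \<Rightarrow> 'n \<Rightarrow> complex \<Rightarrow> complex"
  assumes A: "\<And>i j x. A x $ i $ j = F i j (of_real x)"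
    and hol: "\<And>i j. F i j holomorphic_on strip"
    and bound: "\<And>i j. \<exists>K. \<forall>z\<in>strip. norm (F i j z) \<le> K / (1 + (Re z)\<^sup>2)"
    and "h > 0"
  shows "\<And>\<xi>. integrable lborel (\<lambda>x. cis (- (\<xi> * x)) *\<^sub>M A x)"
    and "(\<lambda>m::int. A (m * h)) summable_on UNIV"
    and "((\<lambda>l::int. LINT x|lborel. cis (- (2 * pi * l / h * x)) *\<^sub>M A x) has_sum
           h *\<^sub>R (\<Sum>\<^sub>\<infinity>m::int. A (m * h))) UNIV"
proof -
  have P: "integrable lborel (\<lambda>x. A x $ i $ j * cis (- (\<xi> * x)))"
    "(\<lambda>m::int. A (m * h) $ i $ j) summable_on UNIV"
    "((\<lambda>l::int. fourier (\<lambda>x. A x $ i $ j) (2 * pi * l / h)) has_sum h *\<^sub>R (\<Sum>\<^sub>\<infinity>m::int. A (m * h) $ i $ j)) UNIV"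
    for i j \<xi>
  proof -
    obtain K where K: "\<And>z. z \<in> strip \<Longrightarrow> norm (F i j z) \<le> K / (1 + (Re z)\<^sup>2)"
      using bound by blast
    show "integrable lborel (\<lambda>x. A x $ i $ j * cis (- (\<xi> * x)))"
      "(\<lambda>m::int. A (m * h) $ i $ j) summable_on UNIV"
      "((\<lambda>l::int. fourier (\<lambda>x. A x $ i $ j) (2 * pi * l / h)) has_sum h *\<^sub>R (\<Sum>\<^sub>\<infinity>m::int. A (m * h) $ i $ j)) UNIV"
      using Poisson_summation_strip[OF hol K \<open>h > 0\<close>] by (simp_all add: A)
  qed
  have int: "has_bochner_integral lborel (\<lambda>x. cis (- (\<xi> * x)) *\<^sub>M A x)
      (\<chi> i j. fourier (\<lambda>x. A x $ i $ j) \<xi>)" for \<xi>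
    by (intro has_bochner_integral_vecI)
       (use has_bochner_integral_integrable[OF P(1)] in \<open>simp add: fourier_def mult.commute[of "A x $ i $ j" for x i j]\<close>)
  show "integrable lborel (\<lambda>x. cis (- (\<xi> * x)) *\<^sub>M A x)" for \<xi>
    using int by (rule integrable.intros)
  have sum: "((\<lambda>m::int. A (m * h)) has_sum (\<chi> i j. \<Sum>\<^sub>\<infinity>m::int. A (m * h) $ i $ j)) UNIV"
    by (intro has_sum_vecI) (simp add: P)
  then show "(\<lambda>m::int. A (m * h)) summable_on UNIV"
    by (rule has_sum_imp_summable)
  have "((\<lambda>l::int. \<chi> i j. fourier (\<lambda>x. A x $ i $ j) (2 * pi * l / h)) has_sum
           h *\<^sub>R (\<chi> i j. \<Sum>\<^sub>\<infinity>m::int. A (m * h) $ i $ j)) UNIV"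
    by (intro has_sum_vecI) (use P(3) in simp)
  then show "((\<lambda>l::int. LINT x|lborel. cis (- (2 * pi * l / h * x)) *\<^sub>M A x) has_sum
           h *\<^sub>R (\<Sum>\<^sub>\<infinity>m::int. A (m * h))) UNIV"
    by (simp only: has_bochner_integral_integral_eq[OF int] infsumI[OF sum])
qed

text \<open>Serves to identify the zero-frequency term of the transformed series with the integral
  over k: sinh increases from minus to plus infinity and has derivative cosh.\<close>

lemma integral_sinh_substitution:
  fixes f :: "real \<Rightarrow> 'a::euclidean_space"
  assumes "\<And>x. isCont f x" and "integrable lborel f" and "integrable lborel (\<lambda>z. cosh z *\<^sub>R f (sinh z))"
  shows "(LINT k|lborel. f k) = (LINT z|lborel. cosh z *\<^sub>R f (sinh z))"
proof -
  have "(LBINT x=-\<infinity>..\<infinity>. f x) = (LBINT x=-\<infinity>..\<infinity>. cosh x *\<^sub>R f (sinh x))"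
  proof (rule interval_integral_substitution_integrable)
    show "((ereal \<circ> sinh \<circ> real_of_ereal) \<longlongrightarrow> - \<infinity>) (at_right (- \<infinity>))"
      using sinh_real_at_bot by (simp add: ereal_tendsto_simps)
    show "((ereal \<circ> sinh \<circ> real_of_ereal) \<longlongrightarrow> \<infinity>) (at_left \<infinity>)"
      using sinh_real_at_top by (simp add: ereal_tendsto_simps)
    show "isCont cosh x" for x :: real
      by (rule DERIV_isCont[of cosh "sinh x"]) (auto intro!: derivative_eq_intros)
  qed (use assms in \<open>auto intro!: derivative_eq_intros simp: set_integrable_def\<close>)
  then show ?thesis
    by (simp add: interval_lebesgue_integral_def set_lebesgue_integral_def)
qed

lemma infsum_eq_sum_plus_infsum:
  fixes f :: "'i \<Rightarrow> 'a::banach"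
  assumes "f summable_on UNIV" and "finite S"
  shows "infsum f UNIV = sum f S + infsum f (UNIV - S)"
  using infsum_Un_disjoint[of f S "UNIV - S"] assms
  by (simp add: summable_on_subset_banach[OF assms(1)])

lemma op_norm_summable_subset:
  fixes f :: "'i \<Rightarrow> complex^'n^'n"
  assumes "f summable_on UNIV"
  shows "op_norm_summable f S"
  by (intro op_norm_summable_if_summable_on summable_on_subset_banach[OF assms]) simp

text \<open>Integrability and operator-norm summability are asserted next to the equations because
  \<open>LINT\<close> and the infinite sum default to 0 when they fail to exist; with them, every
  term is a genuine value.\<close>

theorem mainTheorem7:
  fixes L G :: "complex^'n^'n" and T c \<gamma> h :: real
  assumes "pos_semidef L" and "hermitian G"
    and "T > 0" and "c > 0" and "\<gamma> > 0" and "h > 0"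
  shows
    "(\<forall>a. integrable lborel (weyl_integrand c \<gamma> T L G a))
     \<and> op_norm_summable (\<lambda>m::int. q_kernel c \<gamma> (m * h) *\<^sub>M evol T L G (m * h)) UNIV
     \<and> op_norm_summable (\<lambda>l::int. weyl_op c \<gamma> T L G (2 * pi * l / h)) (UNIV - {0})
     \<and> h *\<^sub>R (\<Sum>\<^sub>\<infinity>m::int. q_kernel c \<gamma> (m * h) *\<^sub>M evol T L G (m * h))
         = weyl_op c \<gamma> T L G 0
           + (\<Sum>\<^sub>\<infinity>l::int\<in>UNIV - {0}. weyl_op c \<gamma> T L G (2 * pi * l / h))
     \<and> (\<forall>N::nat.
         op_norm_summable (\<lambda>m::int. q_kernel c \<gamma> (m * h) *\<^sub>M evol T L G (m * h)) {m. \<bar>m\<bar> > int N}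
         \<and> h *\<^sub>R (\<Sum>m = - int N..int N. q_kernel c \<gamma> (m * h) *\<^sub>M evol T L G (m * h))
               - mexp ((- T) *\<^sub>R (L + \<i> *\<^sub>M G))
           = (weyl_op c \<gamma> T L G 0 - mexp ((- T) *\<^sub>R (L + \<i> *\<^sub>M G)))
             + (\<Sum>\<^sub>\<infinity>l::int\<in>UNIV - {0}. weyl_op c \<gamma> T L G (2 * pi * l / h))
             - h *\<^sub>R (\<Sum>\<^sub>\<infinity>m::int\<in>{m. \<bar>m\<bar> > int N}.
                         q_kernel c \<gamma> (m * h) *\<^sub>M evol T L G (m * h)))
     \<and> (\<forall>l::int. integrable lborel (\<lambda>z.
           (complex_of_real (cosh z) * q_kernel c \<gamma> (sinh z)
             * exp (- 2 * pi * \<i> * l * z / h)) *\<^sub>M evol T L G (sinh z)))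
     \<and> op_norm_summable (\<lambda>m::int.
           (complex_of_real (cosh (m * h)) * q_kernel c \<gamma> (sinh (m * h)))
             *\<^sub>M evol T L G (sinh (m * h))) UNIV
     \<and> op_norm_summable (\<lambda>l::int. LINT z|lborel.
           (complex_of_real (cosh z) * q_kernel c \<gamma> (sinh z)
             * exp (- 2 * pi * \<i> * l * z / h)) *\<^sub>M evol T L G (sinh z)) (UNIV - {0})
     \<and> h *\<^sub>R (\<Sum>\<^sub>\<infinity>m::int.
           (complex_of_real (cosh (m * h)) * q_kernel c \<gamma> (sinh (m * h)))
             *\<^sub>M evol T L G (sinh (m * h)))
         = (LINT k|lborel. q_kernel c \<gamma> k *\<^sub>M evol T L G k)
           + (\<Sum>\<^sub>\<infinity>l::int\<in>UNIV - {0}. LINT z|lborel.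
                (complex_of_real (cosh z) * q_kernel c \<gamma> (sinh z)
                  * exp (- 2 * pi * \<i> * l * z / h)) *\<^sub>M evol T L G (sinh z))"
proof -
  define A where "A k = q_kernel c \<gamma> k *\<^sub>M evol T L G k" for k
  define B where "B z = (complex_of_real (cosh z) * q_kernel c \<gamma> (sinh z)) *\<^sub>M evol T L G (sinh z)" for z
  \<comment> \<open>In both cases the real part is positive on the strip.\<close>
  have nz: "1 + z\<^sup>2 \<noteq> 0" "1 + (sinh z)\<^sup>2 \<noteq> 0" if "z \<in> strip" for z
  proof -
    show "1 + z\<^sup>2 \<noteq> 0"
      using Re_square_strip(2)[OF that] by (auto simp: complex_eq_iff)
    have "0 < (cosh (Re z))\<^sup>2 / 2" by simp
    with Re_cosh_square_strip[OF that] show "1 + (sinh z)\<^sup>2 \<noteq> 0"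
      by (auto simp: cosh_square_eq complex_eq_iff)
  qed
  have hol_evol: "(\<lambda>z. evol_complex T L G (g z) $ i $ j) holomorphic_on strip"
    if "g holomorphic_on strip" for g i j
    using holomorphic_on_compose_gen[OF that holomorphic_evol_complex] by (simp add: o_def)
  have A_entry: "A x $ i $ j = q_complex c \<gamma> (of_real x) * evol_complex T L G (of_real x) $ i $ j" for x i j
    by (simp add: A_def q_kernel_eq_q_complex evol_eq_evol_complex)
  have B_entry: "B x $ i $ j = cosh (of_real x) * q_complex c \<gamma> (sinh (of_real x)) * evol_complex T L G (sinh (of_real x)) $ i $ j"
    for x i j
    by (simp add: B_def q_kernel_eq_q_complex evol_eq_evol_complex cosh_sinh_of_real)
  have hol_A: "(\<lambda>z. q_complex c \<gamma> z * evol_complex T L G z $ i $ j) holomorphic_on strip" for i j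
    by (intro holomorphic_intros holomorphic_q_complex hol_evol nz assms)
  have hol_cosh_sinh: "(\<lambda>z. cosh z) holomorphic_on strip" "(\<lambda>z. sinh z) holomorphic_on strip"
    by (simp only: cosh_conv_cos sinh_conv_sin, intro holomorphic_intros)+
  have hol_B: "(\<lambda>z. cosh z * q_complex c \<gamma> (sinh z) * evol_complex T L G (sinh z) $ i $ j) holomorphic_on strip" for i j
    by (intro holomorphic_on_mult holomorphic_q_complex hol_cosh_sinh hol_evol nz(2) assms)
  note PA = matrix_Poisson_summation[OF A_entry hol_A q_evol_strip_decay[OF \<open>c > 0\<close> \<open>\<gamma> > 0\<close>] \<open>h > 0\<close>]
  note PB = matrix_Poisson_summation[OF B_entry hol_B cosh_q_evol_sinh_strip_decay[OF \<open>c > 0\<close> \<open>\<gamma> > 0\<close>] \<open>h > 0\<close>]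

  \<comment> \<open>The symbol shift a enters as the Fourier frequency a, so the shift 2 pi l / h is
    precisely the l-th sample in Poisson summation.\<close>
  have weyl_A: "weyl_integrand c \<gamma> T L G a = (\<lambda>k. cis (- (a * k)) *\<^sub>M A k)" for a
    by (simp add: fun_eq_iff vec_eq_iff weyl_integrand_def A_def cis_conv_exp mult_ac)
  have sinh_B: "(\<lambda>z. (complex_of_real (cosh z) * q_kernel c \<gamma> (sinh z) * exp (- 2 * pi * \<i> * l * z / h))
      *\<^sub>M evol T L G (sinh z)) = (\<lambda>z. cis (- (2 * pi * l / h * z)) *\<^sub>M B z)" for l :: int
    by (simp add: fun_eq_iff vec_eq_iff B_def cis_conv_exp mult_ac)
  have one: "1 *\<^sub>M M = M" for M :: "complex^'n^'n"
    by (simp add: vec_eq_iff)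

  have W_sum: "((\<lambda>l::int. weyl_op c \<gamma> T L G (2 * pi * l / h)) has_sum h *\<^sub>R (\<Sum>\<^sub>\<infinity>m::int. A (m * h))) UNIV"
    using PA(3) by (simp add: weyl_op_def weyl_A)
  have W_split: "h *\<^sub>R (\<Sum>\<^sub>\<infinity>m::int. A (m * h))
      = weyl_op c \<gamma> T L G 0 + (\<Sum>\<^sub>\<infinity>l::int\<in>UNIV - {0}. weyl_op c \<gamma> T L G (2 * pi * l / h))"
    using infsum_eq_sum_plus_infsum[OF has_sum_imp_summable[OF W_sum], of "{0}"] infsumI[OF W_sum] by simp
  have tail: "{m::int. \<bar>m\<bar> > int N} = UNIV - {- int N..int N}" for N
    by auto
  \<comment> \<open>Pure rearrangement of \<open>W_split\<close>, valid for an arbitrary matrix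
    \<open>R\<close>; the truncated identity is the instance with \<open>R\<close> the target
    exponential.\<close>
  have N_split: "h *\<^sub>R (\<Sum>m = - int N..int N. A (m * h)) - R
      = (weyl_op c \<gamma> T L G 0 - R) + (\<Sum>\<^sub>\<infinity>l::int\<in>UNIV - {0}. weyl_op c \<gamma> T L G (2 * pi * l / h))
        - h *\<^sub>R (\<Sum>\<^sub>\<infinity>m::int\<in>{m. \<bar>m\<bar> > int N}. A (m * h))" for N R
    using W_split infsum_eq_sum_plus_infsum[OF PA(2), of "{- int N..int N}"]
    by (simp add: tail scaleR_right_distrib algebra_simps)

  let ?J = "\<lambda>l::int. LINT z|lborel. cis (- (2 * pi * l / h * z)) *\<^sub>M B z"
  have J0: "?J 0 = (LINT k|lborel. A k)"
  proof -
    have cosh_A: "cosh z *\<^sub>R A (sinh z) = B z" for z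
      by (simp add: vec_eq_iff A_def B_def scaleR_conv_of_real[where 'a = complex] mult_ac)
    have "continuous_on UNIV A"
    proof -
      have "continuous_on UNIV (\<lambda>x. A x $ i $ j)" for i j
        unfolding A_entry
        by (rule continuous_on_compose2[OF holomorphic_on_imp_continuous_on[OF hol_A]]) (auto intro!: continuous_intros)
      then have "continuous_on UNIV (\<lambda>x. \<chi> i j. A x $ i $ j)"
        by (intro continuous_on_vec_lambda)
      then show ?thesis by simp
    qed
    then have "isCont A x" for x
      by (simp add: continuous_on_eq_continuous_at)
    moreover have "integrable lborel A" "integrable lborel B"
      using PA(1)[of 0] PB(1)[of 0] by (simp_all add: one)
    ultimately show ?thesis
      using integral_sinh_substitution[of A] by (simp add: cosh_A one)
  qed
  have J_split: "h *\<^sub>R (\<Sum>\<^sub>\<infinity>m::int. B (m * h)) = (LINT k|lborel. A k) + (\<Sum>\<^sub>\<infinity>l::int\<in>UNIV - {0}. ?J l)"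
    using infsum_eq_sum_plus_infsum[OF has_sum_imp_summable[OF PB(3)], of "{0}"] infsumI[OF PB(3)] J0 by simp
  show ?thesis
    unfolding sinh_B
    unfolding A_def[symmetric] B_def[symmetric]
    using PA(1) PB(1) W_split N_split J_split
      op_norm_summable_subset[OF PA(2)] op_norm_summable_subset[OF PB(2)]
      op_norm_summable_subset[OF has_sum_imp_summable[OF W_sum]]
      op_norm_summable_subset[OF has_sum_imp_summable[OF PB(3)]]
    unfolding weyl_A by blast
qed

end
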